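(* Assume that $p$ is a selective ultrafilter and that $\kappa$ is an infinite cardinal with $\kappa=\kappa^\omega$. Then there exists a $p$-compact group topology on the additive group $G=\mathbb{Q}^{(\kappa)}$ without non-trivial convergent sequences.
   Context: $\mathbb{Q}^{(\kappa)}=\{g\in\mathbb{Q}^\kappa : \operatorname{supp} g \text{ is finite}\}$ with pointwise addition (the direct sum of $\kappa$ copies of $\mathbb{Q}$), where $\operatorname{supp} g=\{\mu\in\kappa: g(\mu)\neq 0\}$. A selective ultrafilter is a free (non-principal) ultrafilter $p$ on $\omega$ such that for every partition of $\omega$ into sets not belonging to $p$ there is an element of $p$ meeting each piece of the partition in at most one point. For a sequence $(x_n)_{n\in\omega}$ in a topological space $X$, a point $x$ is a $p$-limit of the sequence, $x=p\text{-}\lim x_n$, if $\{n\in\omega: x_n\in U\}\in p$ for every neighborhood $U$ of $x$. A space $X$ is $p$-compact if every sequence $(x_n)_{n\in\omega}$ in $X$ has a $p$-limit in $X$. A group topology is a topology making the group operations continuous. A convergent sequence is non-trivial if it is not eventually constant. *)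

theory Defs
  imports "HOL-Analysis.Analysis" "HOL-Library.Disjoint_Sets" "HOL-Library.Poly_Mapping"
begin

text \<open>Ultrafilters on a type are represented by library filters: a set \<open>A\<close> belongs to the
  filter \<open>p\<close> iff \<open>\<forall>\<^sub>F n in p. n \<in> A\<close>.\<close>

definition ultrafilter :: "'a filter \<Rightarrow> bool" where
  "ultrafilter p \<longleftrightarrow>
     p \<noteq> bot \<and> (\<forall>A. (\<forall>\<^sub>F n in p. n \<in> A) \<or> (\<forall>\<^sub>F n in p. n \<in> - A))"

definition free_ultrafilter :: "'a filter \<Rightarrow> bool" where
  "free_ultrafilter p \<longleftrightarrow> ultrafilter p \<and> (\<nexists>a. p = principal {a})"

definition selective_ultrafilter :: "nat filter \<Rightarrow> bool" where
  "selective_ultrafilter p \<longleftrightarrow>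
     free_ultrafilter p \<and>
     (\<forall>P. partition_on UNIV P \<and> (\<forall>A\<in>P. \<not> (\<forall>\<^sub>F n in p. n \<in> A)) \<longrightarrow>
        (\<exists>B. (\<forall>\<^sub>F n in p. n \<in> B) \<and>
             (\<forall>A\<in>P. \<forall>m\<in>A \<inter> B. \<forall>n\<in>A \<inter> B. m = n)))"

text \<open>\<open>limitin X x l p\<close> says exactly that \<open>l\<close> is a \<open>p\<close>-limit of the sequence \<open>x\<close> in the
  space \<open>X\<close>; it includes \<open>l \<in> topspace X\<close>.\<close>

definition p_compact_space :: "nat filter \<Rightarrow> 'a topology \<Rightarrow> bool" where
  "p_compact_space p X \<longleftrightarrow>
     (\<forall>x :: nat \<Rightarrow> 'a. (\<forall>n. x n \<in> topspace X) \<longrightarrow> (\<exists>l. limitin X x l p))"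

text \<open>The direct sum of \<open>\<kappa>\<close> copies of the rationals, indexed by \<open>Field \<kappa>\<close>. The elements of
  \<open>'k \<Rightarrow>\<^sub>0 rat\<close> are the finitely supported functions, their addition is pointwise, and
  \<open>Poly_Mapping.keys g\<close> is the support of \<open>g\<close>.\<close>

definition rat_direct_sum :: "'k rel \<Rightarrow> ('k \<Rightarrow>\<^sub>0 rat) set" where
  "rat_direct_sum \<kappa> = {g. Poly_Mapping.keys g \<subseteq> Field \<kappa>}"

definition group_topology_on :: "'a::ab_group_add set \<Rightarrow> 'a topology \<Rightarrow> bool" where
  "group_topology_on G X \<longleftrightarrow>
     topspace X = G \<and>
     continuous_map (prod_topology X X) X (\<lambda>(a, b). a + b) \<and>
     continuous_map X X uminus"

definition no_nontrivial_convergent_sequences :: "'a topology \<Rightarrow> bool" where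
  "no_nontrivial_convergent_sequences X \<longleftrightarrow>
     (\<forall>(x :: nat \<Rightarrow> 'a) l. (\<forall>n. x n \<in> topspace X) \<and> limitin X x l sequentially \<longrightarrow>
        (\<exists>c. \<forall>\<^sub>F n in sequentially. x n = c))"

end

theory Submission
  imports Defs "HOL-Library.Multiset" "HOL-Library.Function_Algebras"
begin

text \<open>
  In a Hausdorff \<open>p\<close>-compact group topology on the vector space \<open>G =
  \<rat>\<^bsup>(\<kappa>)\<^esup>\<close>, taking limits along \<open>p\<close> is a linear map
  from sequences to \<open>G\<close>. The construction reverses this: a linear map
  \<open>L\<close> from sequences to \<open>G\<close> is fixed first, subject to \<open>L w =
  a\<close> whenever \<open>w n = a\<close> for \<open>p\<close>-many \<open>n\<close>, and
  \<open>G\<close> gets the initial topology for the set \<open>\<Phi>\<close> of all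
  homomorphisms \<open>\<phi>\<close> to the unit circle (characters) such that \<open>\<phi> (w
  n)\<close> tends to \<open>\<phi> (L w)\<close> along \<open>p\<close> for every sequence
  \<open>w\<close>. Then \<open>L w\<close> is a limit of \<open>w\<close> along \<open>p\<close>
  by construction, and this is a group topology. A non-trivial convergent sequence would give rise
  to an injective sequence \<open>z\<close> with \<open>\<phi> (z j)\<close> tending to
  \<open>1\<close> for all \<open>\<phi>\<close> in \<open>\<Phi>\<close>
  (\<open>no_nontrivial_convergent_sequences_character_topology\<close>), so it remains to see
  that \<open>\<Phi>\<close> is rich enough to exclude this
  (\<open>character_detecting_sequence\<close>).

  The richness of \<open>\<Phi>\<close> depends on the choice of \<open>L\<close> in
  \<open>limit_functional\<close>. Since \<open>\<kappa> = \<kappa>\<^sup>\<omega>\<close>, there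
  are only \<open>\<kappa>\<close> sequences, and countable subsets of \<open>\<kappa>\<close> are
  bounded by Koenig's argument. Hence \<open>L\<close> can send the elements \<open>f\<close> of a
  basis of the sequences modulo the essentially constant ones to different unit vectors, each with
  an index above the supports of all \<open>f n\<close>. A character prescribed on countably many
  coordinates in a way compatible with \<open>L\<close> then extends to an element of
  \<open>\<Phi>\<close> by recursion along \<open>\<kappa>\<close>: every new value is a limit of
  old ones (\<open>extend_character\<close>).

  This leaves a countable problem, where selectivity enters: to find a character on a countable
  group which has given limits along \<open>p\<close> on countably many sequences, provided that
  these limits respect all relations between the sequences that hold \<open>p\<close>-essentially
  and that no combination of the sequences is essentially a non-zero constant
  (\<open>character_interpolation\<close>). By a quantitative form of Kronecker's theorem
  (\<open>kronecker_approximation\<close>), only finitely many relations can prevent a given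
  character from being corrected, with a small change at finitely many elements, so that it nearly
  attains finitely many targets at place \<open>n\<close>; so the correction is possible for
  \<open>p\<close>-many \<open>n\<close>. A selective ultrafilter contains a set whose every
  element is good for the requirements collected up to the previous one
  (\<open>selective_ultrafilter_diagonal\<close>), and correcting successively along this set
  yields a convergent sequence of characters. The targets are \<open>1\<close> on the sequences
  that define compatibility with \<open>L\<close> and \<open>- 1\<close> on a subsequence of
  \<open>z\<close> chosen independent of them.\<close>

section \<open>Characters of abelian groups\<close>

definition character_on :: "'a::ab_group_add set \<Rightarrow> ('a \<Rightarrow> complex) \<Rightarrow> bool" where
  "character_on H \<phi> \<longleftrightarrow>
     (\<forall>a\<in>H. cmod (\<phi> a) = 1) \<and> (\<forall>a\<in>H. \<forall>b\<in>H. \<phi> (a + b) = \<phi> a * \<phi> b)"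

lemma character_onD:
  assumes "character_on H \<phi>"
  shows "a \<in> H \<Longrightarrow> cmod (\<phi> a) = 1" "a \<in> H \<Longrightarrow> b \<in> H \<Longrightarrow> \<phi> (a + b) = \<phi> a * \<phi> b"
  using assms by (auto simp: character_on_def)

lemma character_on_zero:
  assumes "character_on H \<phi>" "0 \<in> H"
  shows "\<phi> 0 = 1"
proof -
  have "\<phi> 0 = \<phi> 0 * \<phi> 0" "\<phi> 0 \<noteq> 0"
    using character_onD[OF assms(1), of 0] assms(2) by fastforce+
  then show ?thesis by simp
qed

lemma character_on_minus:
  assumes "character_on H \<phi>" "0 \<in> H" "a \<in> H" "- a \<in> H"
  shows "\<phi> (- a) = cnj (\<phi> a)"
proof -
  have "\<phi> a * \<phi> (- a) = 1"
    using character_on_zero[OF assms(1,2)] character_onD(2)[OF assms(1,3,4)] by simp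
  moreover have "\<phi> a * cnj (\<phi> a) = 1"
    using character_onD(1)[OF assms(1,3)] by (simp add: complex_norm_square[symmetric])
  ultimately show ?thesis
    by (metis mult.assoc mult.commute mult.right_neutral)
qed

lemma character_on_diff:
  assumes "character_on UNIV \<phi>"
  shows "\<phi> (a - b) = \<phi> a * cnj (\<phi> b)"
  using character_onD(2)[OF assms, of a "- b"] character_on_minus[OF assms, of b] by simp

lemma character_on_sum_mset:
  assumes "character_on UNIV \<phi>"
  shows "\<phi> (\<Sum>x\<in>#M. f x) = (\<Prod>x\<in>#M. \<phi> (f x))"
  by (induction M) (auto simp: character_on_zero[OF assms] character_onD(2)[OF assms])

lemma character_on_sum:
  assumes "character_on UNIV \<phi>"
  shows "\<phi> (\<Sum>x\<in>B. f x) = (\<Prod>x\<in>B. \<phi> (f x))"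
  by (induction B rule: infinite_finite_induct)
     (auto simp: character_on_zero[OF assms] character_onD(2)[OF assms])

lemma character_on_prod:
  assumes "\<And>v. v \<in> Q \<Longrightarrow> character_on UNIV (\<psi> v)"
  shows "character_on UNIV (\<lambda>a. \<Prod>v\<in>Q. \<psi> v a)"
  using assms by (auto simp: character_on_def prod_norm[symmetric] prod.distrib[symmetric] intro!: prod.cong)

section \<open>A quantitative Kronecker theorem\<close>

lemma prod_one_plus:
  fixes y :: "'b \<Rightarrow> 'c::comm_semiring_1"
  assumes "finite P"
  shows "(\<Prod>x\<in>P. 1 + y x) = (\<Sum>B\<in>Pow P. \<Prod>x\<in>B. y x)"
  using prod_add[OF assms, of "\<lambda>_. 1" y] prod_add[OF assms, of y "\<lambda>_. 1"]
  by (simp add: add.commute)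

text \<open>Cauchy--Schwarz applied to the sizes of the fibres of \<open>f\<close>.\<close>
lemma card_square_le_collisions:
  assumes "finite X"
  shows "(card X)\<^sup>2 \<le> card (f ` X) * card {(x, x'). x \<in> X \<and> x' \<in> X \<and> f x = f x'}"
proof -
  define c where "c y = card {x \<in> X. f x = y}" for y
  have X: "card X = (\<Sum>y\<in>f ` X. c y)"
    unfolding c_def using assms sum.image_gen[OF assms, of "\<lambda>_. 1::nat" f] by simp
  have "{(x, x'). x \<in> X \<and> x' \<in> X \<and> f x = f x'}
      = (SIGMA x : X. {x' \<in> X. f x' = f x})" by auto
  then have "card {(x, x'). x \<in> X \<and> x' \<in> X \<and> f x = f x'} = (\<Sum>x\<in>X. c (f x))"
    using assms by (simp add: c_def)
  also have "\<dots> = (\<Sum>y\<in>f ` X. \<Sum>x\<in>{x \<in> X. f x = y}. c (f x))"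
    by (rule sum.image_gen[OF assms])
  also have "\<dots> = (\<Sum>y\<in>f ` X. (c y)\<^sup>2)"
    by (intro sum.cong) (auto simp: c_def power2_eq_square)
  finally have S: "card {(x, x'). x \<in> X \<and> x' \<in> X \<and> f x = f x'} = (\<Sum>y\<in>f ` X. (c y)\<^sup>2)" .
  have "(\<Sum>y\<in>f ` X. real (c y) * 1)\<^sup>2 \<le> (\<Sum>y\<in>f ` X. (real (c y))\<^sup>2) * (\<Sum>y\<in>f ` X. 1\<^sup>2)"
    by (rule Cauchy_Schwarz_ineq_sum)
  then have "real ((\<Sum>y\<in>f ` X. c y)\<^sup>2) \<le> real ((\<Sum>y\<in>f ` X. (c y)\<^sup>2) * card (f ` X))"
    by simp
  then show ?thesis unfolding X S of_nat_le_iff by (simp add: mult.commute)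
qed

text \<open>
  Expanding \<open>(\<Prod>j\<in>J. (1 + y j)) ^ M\<close> gives one monomial for each set of
  positions in \<open>J \<times> {..<M}\<close>. The monomial only depends on how often each index
  \<open>j\<close> occurs, which is recorded by \<open>index_mset\<close>. Hence there are
  exponentially many monomials but only polynomially many (in \<open>M\<close>) different ones.\<close>
definition position_sets :: "'j set \<Rightarrow> nat \<Rightarrow> ('j \<times> nat) set set" where
  "position_sets J M = Pow (J \<times> {..<M})"

definition index_mset :: "('j \<times> nat) set \<Rightarrow> 'j multiset" where
  "index_mset B = image_mset fst (mset_set B)"

lemma sum_index_mset: "(\<Sum>j\<in>#index_mset B. f j) = (\<Sum>x\<in>B. f (fst x))"
  by (simp add: index_mset_def sum_unfold_sum_mset multiset.map_comp o_def)

lemma prod_index_mset: "(\<Prod>j\<in>#index_mset B. f j) = (\<Prod>x\<in>B. f (fst x))"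
  by (simp add: index_mset_def prod_unfold_prod_mset multiset.map_comp o_def)

lemma index_mset_subset:
  assumes "B \<in> position_sets J M" "finite J"
  shows "set_mset (index_mset B) \<subseteq> J"
proof -
  have "finite B" using assms finite_subset[of B "J \<times> {..<M}"] by (auto simp: position_sets_def)
  then show ?thesis using assms by (auto simp: index_mset_def position_sets_def)
qed

lemma card_index_msets:
  assumes "finite J"
  shows "card (index_mset ` position_sets J M) \<le> (M + 1) ^ card J"
proof -
  let ?r = "\<lambda>C. restrict (count C) J"
  have sub: "set_mset C \<subseteq> J" if "C \<in> index_mset ` position_sets J M" for C
    using that index_mset_subset[OF _ assms] by fastforce
  have "inj_on ?r (index_mset ` position_sets J M)"
  proof (rule inj_onI)
    fix C D assume C: "C \<in> index_mset ` position_sets J M" and D: "D \<in> index_mset ` position_sets J M"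
      and eq: "?r C = ?r D"
    show "C = D"
    proof (rule multiset_eqI)
      fix j show "count C j = count D j"
      proof (cases "j \<in> J")
        case True then show ?thesis using fun_cong[OF eq, of j] by simp
      next
        case False
        then have "j \<notin># C" "j \<notin># D" using sub[OF C] sub[OF D] by auto
        then show ?thesis by (simp add: not_in_iff)
      qed
    qed
  qed
  moreover have "?r ` (index_mset ` position_sets J M) \<subseteq> (\<Pi>\<^sub>E j\<in>J. {..M})"
  proof clarify
    fix B assume B: "B \<in> position_sets J M"
    have fB: "finite B"
      using B assms finite_subset[of B "J \<times> {..<M}"] by (auto simp: position_sets_def)
    have "count (index_mset B) j \<le> M" for j
    proof -
      have "count (index_mset B) j = card {x \<in> B. fst x = j}"
        using fB by (auto simp: index_mset_def count_image_mset' intro!: arg_cong[where f=card])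
      also have "\<dots> \<le> card ({j} \<times> {..<M})"
        using B by (intro card_mono) (auto simp: position_sets_def)
      finally show ?thesis by simp
    qed
    then show "?r (index_mset B) \<in> (\<Pi>\<^sub>E j\<in>J. {..M})" by auto
  qed
  ultimately have "card (index_mset ` position_sets J M) \<le> card (\<Pi>\<^sub>E j\<in>J. {..M::nat})"
    using assms by (intro card_inj_on_le) (auto intro!: finite_PiE)
  then show ?thesis using assms by (simp add: card_PiE)
qed

text \<open>
  A finite substitute for Haar measure on the dual group: with \<open>\<psi> v v = - 1\<close>,
  the sum over all products of the \<open>\<psi> v\<close> factors as \<open>\<Prod>v. (1 + \<psi>
  v a)\<close>, and the factor belonging to \<open>a\<close> vanishes at \<open>a\<close>.\<close>
lemma orthogonal_characters:
  fixes V :: "'a::ab_group_add set"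
  assumes sep: "\<And>v::'a. v \<noteq> 0 \<Longrightarrow> \<exists>\<psi>. character_on UNIV \<psi> \<and> \<psi> v = - 1" and "finite V"
  obtains \<Omega> :: "'a set set" and \<eta> where "finite \<Omega>" "\<Omega> \<noteq> {}"
    "\<And>Q. character_on UNIV (\<eta> Q)"
    "\<And>v. v \<in> V \<Longrightarrow> (\<Sum>Q\<in>\<Omega>. \<eta> Q v) = (if v = 0 then of_nat (card \<Omega>) else 0)"
proof -
  obtain \<psi> where \<psi>: "\<And>v::'a. v \<noteq> 0 \<Longrightarrow> character_on UNIV (\<psi> v) \<and> \<psi> v v = - 1"
    using sep by metis
  define W where "W = V - {0}"
  have fW: "finite W" using assms by (simp add: W_def)
  define \<eta> where "\<eta> Q a = (\<Prod>v\<in>Q - {0}. \<psi> v a)" for Q a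
  have ch: "character_on UNIV (\<eta> Q)" for Q
    unfolding \<eta>_def using \<psi> by (intro character_on_prod) auto
  have S: "(\<Sum>Q\<in>Pow W. \<eta> Q a) = (\<Prod>v\<in>W. 1 + \<psi> v a)" for a
  proof -
    have "\<eta> Q a = (\<Prod>v\<in>Q. \<psi> v a)" if "Q \<in> Pow W" for Q
    proof -
      have "Q - {0} = Q" using that by (auto simp: W_def)
      then show ?thesis by (simp add: \<eta>_def)
    qed
    then show ?thesis using prod_one_plus[OF fW, of "\<lambda>v. \<psi> v a"] by simp
  qed
  have "(\<Sum>Q\<in>Pow W. \<eta> Q v) = (if v = 0 then of_nat (card (Pow W)) else 0)" if "v \<in> V" for v
  proof (cases "v = 0")
    case True
    then show ?thesis using character_on_zero[OF ch] by simp
  next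
    case False
    then have "v \<in> W" "1 + \<psi> v v = 0" using that \<psi> by (auto simp: W_def)
    then have "(\<Prod>v'\<in>W. 1 + \<psi> v' v) = 0" using fW by (auto intro!: prod_zero)
    then show ?thesis using False S by simp
  qed
  moreover have "finite (Pow W)" "Pow W \<noteq> {}" using fW by auto
  ultimately show thesis using that[of "Pow W" \<eta>] ch by blast
qed

lemma cmod_one_plus_squared:
  assumes "cmod z = 1"
  shows "(cmod (1 + z))\<^sup>2 = 4 - (cmod (z - 1))\<^sup>2"
proof -
  have "(Re z)\<^sup>2 + (Im z)\<^sup>2 = 1" using assms by (simp add: cmod_def)
  then show ?thesis unfolding cmod_power2 by (simp add: power2_eq_square algebra_simps)
qed

lemma exists_power_small:
  fixes \<rho> :: real
  assumes "0 \<le> \<rho>" "\<rho> < 1"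
  shows "\<exists>M::nat. real (M + 1) ^ n * \<rho> ^ M < 1"
proof (cases "n = 0 \<or> \<rho> = 0")
  case True
  then show ?thesis using assms by (auto intro!: exI[of _ 1])
next
  case False
  define \<sigma> where "\<sigma> = root n \<rho>"
  have \<sigma>: "\<sigma> ^ n = \<rho>" "0 < \<sigma>" "\<sigma> < 1" using False assms by (auto simp: \<sigma>_def)
  have "(\<lambda>M. real M * \<sigma> ^ M) \<longlonglongrightarrow> 0"
    using powser_times_n_limit_0[of \<sigma>] \<sigma> by simp
  then have "(\<lambda>M. (real (Suc M) * \<sigma> ^ Suc M) / \<sigma>) \<longlonglongrightarrow> 0 / \<sigma>"
    using \<sigma> by (intro tendsto_divide tendsto_const LIMSEQ_Suc) auto
  then have lim: "(\<lambda>M. (real (M + 1) * \<sigma> ^ M) ^ n) \<longlonglongrightarrow> 0 ^ n"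
    using \<sigma> by (intro tendsto_power) (simp add: mult.assoc[symmetric] del: of_nat_Suc)
  have "(0::real) ^ n < 1" using False by (simp add: power_0_left)
  with lim have "eventually (\<lambda>M. (real (M + 1) * \<sigma> ^ M) ^ n < 1) sequentially"
    by (rule order_tendstoD(2))
  then obtain M where "(real (M + 1) * \<sigma> ^ M) ^ n < 1"
    using eventually_happens'[OF trivial_limit_sequentially] by blast
  moreover have "(real (M + 1) * \<sigma> ^ M) ^ n = real (M + 1) ^ n * \<rho> ^ M"
    unfolding \<sigma>(1)[symmetric] power_mult_distrib power_mult[symmetric] by (simp only: mult.commute)
  ultimately show ?thesis by metis
qed

text \<open>
  The point of this form of Kronecker's theorem is that the finite set \<open>\<C>\<close> of
  relevant relations depends on \<open>J\<close> and \<open>\<epsilon>\<close> only: being uniform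
  in \<open>a\<close>, it can be applied to ultrafilter-many tuples at once.

  The proof averages \<open>\<bar>\<Prod>j\<in>J. (1 + \<phi> (a j) * cnj (t j)) ^
  M\<bar>\<^sup>2\<close> over a family of characters that is orthogonal on all elements in
  question. If every \<open>\<phi>\<close> misses some \<open>t j\<close> by
  \<open>\<epsilon>\<close>, then the average is at most \<open>4 ^ (card J * M) * \<rho> ^
  M\<close> with \<open>\<rho> < 1\<close>. On the other hand, after expansion exactly the pairs
  of monomials with the same group element survive; the hypothesis on relations makes each of them
  contribute \<open>1\<close>, and there are at least \<open>4 ^ (card J * M) / (M + 1) ^ card
  J\<close> such pairs.\<close>
lemma kronecker_approximation:
  fixes J :: "'j set" and \<epsilon> :: real
  assumes sep: "\<And>v::'a::ab_group_add. v \<noteq> 0 \<Longrightarrow> \<exists>\<psi>. character_on UNIV \<psi> \<and> \<psi> v = - 1"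
    and J: "finite J" and \<epsilon>: "\<epsilon> > 0"
  obtains \<C> :: "'j multiset set" where "finite \<C>" "\<And>C. C \<in> \<C> \<Longrightarrow> set_mset C \<subseteq> J"
    "\<And>(a::'j \<Rightarrow> 'a) t. (\<And>j. j \<in> J \<Longrightarrow> cmod (t j) = 1) \<Longrightarrow>
       (\<And>C D. C \<in> \<C> \<Longrightarrow> D \<in> \<C> \<Longrightarrow> (\<Sum>j\<in>#C. a j) = (\<Sum>j\<in>#D. a j) \<Longrightarrow>
          (\<Prod>j\<in>#C. t j) = (\<Prod>j\<in>#D. t j)) \<Longrightarrow>
       \<exists>\<phi>. character_on UNIV \<phi> \<and> (\<forall>j\<in>J. cmod (\<phi> (a j) - t j) < \<epsilon>)"
proof -
  define \<rho> where "\<rho> = max 0 (1 - \<epsilon>\<^sup>2 / 4)"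
  have \<rho>: "0 \<le> \<rho>" "\<rho> < 1" using \<epsilon> by (auto simp: \<rho>_def)
  obtain M where M: "real (M + 1) ^ card J * \<rho> ^ M < 1"
    using exists_power_small[OF \<rho>] by blast
  define X where "X = position_sets J M"
  define P where "P = J \<times> {..<M}"
  have fP: "finite P" and X: "X = Pow P" and fX: "finite X"
    using J by (auto simp: P_def X_def position_sets_def)
  have approx: "\<exists>\<phi>. character_on UNIV \<phi> \<and> (\<forall>j\<in>J. cmod (\<phi> (a j) - t j) < \<epsilon>)"
    if t: "\<And>j. j \<in> J \<Longrightarrow> cmod (t j) = 1"
      and rel: "\<And>C D. C \<in> index_mset ` X \<Longrightarrow> D \<in> index_mset ` X \<Longrightarrow> (\<Sum>j\<in>#C. a j) = (\<Sum>j\<in>#D. a j) \<Longrightarrow>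
          (\<Prod>j\<in>#C. t j) = (\<Prod>j\<in>#D. t j)"
    for a :: "'j \<Rightarrow> 'a" and t
  proof (rule ccontr)
    assume neg: "\<not> ?thesis"
    define s where "s B = (\<Sum>x\<in>B. a (fst x))" for B :: "('j \<times> nat) set"
    define T where "T B = (\<Prod>x\<in>B. t (fst x))" for B :: "('j \<times> nat) set"
    have T1: "cmod (T B) = 1" if "B \<in> X" for B
      using that t unfolding T_def X P_def by (auto simp: prod_norm[symmetric] intro!: prod.neutral)
    have T: "T B = T B'" if "B \<in> X" "B' \<in> X" "s B = s B'" for B B'
      using rel[of "index_mset B" "index_mset B'"] that by (auto simp: sum_index_mset prod_index_mset s_def T_def)
    obtain \<Omega> :: "'a set set" and \<eta> where \<Omega>: "finite \<Omega>" "\<Omega> \<noteq> {}"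
      and \<eta>: "\<And>Q. character_on UNIV (\<eta> Q)"
      and orth: "\<And>v. v \<in> (\<lambda>(B, B'). s B - s B') ` (X \<times> X) \<Longrightarrow>
        (\<Sum>Q\<in>\<Omega>. \<eta> Q v) = (if v = 0 then of_nat (card \<Omega>) else 0)"
      using orthogonal_characters[OF sep, of "(\<lambda>(B, B'). s B - s B') ` (X \<times> X)"] fX by blast
    define g where "g Q = (\<Prod>x\<in>P. 1 + \<eta> Q (a (fst x)) * cnj (t (fst x)))" for Q
    have g: "g Q = (\<Sum>B\<in>X. \<eta> Q (s B) * cnj (T B))" for Q
      unfolding g_def prod_one_plus[OF fP] X s_def T_def
      by (simp add: prod.distrib character_on_sum[OF \<eta>])
    \<comment> \<open>one bad factor is at most \<open>4 * \<rho>\<close>, all others are at most \<open>4\<close>\<close>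
    have small: "(cmod (g Q))\<^sup>2 \<le> 4 ^ (card J * M) * \<rho> ^ M" for Q
    proof -
      define y where "y j = \<eta> Q (a j) * cnj (t j)" for j
      obtain i where i: "i \<in> J" "\<not> cmod (\<eta> Q (a i) - t i) < \<epsilon>"
        using neg \<eta>[of Q] by blast
      have y1: "cmod (y j) = 1" if "j \<in> J" for j
        using t[OF that] character_onD(1)[OF \<eta>] by (simp add: y_def norm_mult)
      have yt: "\<eta> Q (a j) - t j = t j * (y j - 1)" if "j \<in> J" for j
        using t[OF that] by (simp add: y_def algebra_simps complex_norm_square[symmetric])
      have le4: "(cmod (1 + y j))\<^sup>2 \<le> 4" if "j \<in> J" for j
        using cmod_one_plus_squared[OF y1[OF that]] by simp
      have "\<epsilon> \<le> cmod (y i - 1)"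
        using i(2) yt[OF i(1)] t[OF i(1)] by (simp add: norm_mult)
      then have "\<epsilon>\<^sup>2 \<le> (cmod (y i - 1))\<^sup>2" using \<epsilon> by (intro power_mono) auto
      then have lei: "(cmod (1 + y i))\<^sup>2 \<le> 4 * \<rho>"
        using cmod_one_plus_squared[OF y1[OF i(1)]] by (auto simp: \<rho>_def max_def)
      have "(cmod (g Q))\<^sup>2 = (\<Prod>j\<in>J. (cmod (1 + y j))\<^sup>2) ^ M"
      proof -
        have "g Q = (\<Prod>j\<in>J. (1 + y j) ^ M)"
          unfolding g_def P_def y_def using prod.Sigma[of J "\<lambda>_. {..<M}" "\<lambda>j _. 1 + \<eta> Q (a j) * cnj (t j)"] J
          by (simp add: case_prod_beta)
        then show ?thesis
          by (simp add: prod_norm[symmetric] norm_power prod_power_distrib power_mult[symmetric] mult.commute)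
      qed
      also have "(\<Prod>j\<in>J. (cmod (1 + y j))\<^sup>2) \<le> 4 ^ card J * \<rho>"
      proof -
        have "(\<Prod>j\<in>J. (cmod (1 + y j))\<^sup>2) = (cmod (1 + y i))\<^sup>2 * (\<Prod>j\<in>J - {i}. (cmod (1 + y j))\<^sup>2)"
          using J i(1) by (rule prod.remove)
        also have "\<dots> \<le> (4 * \<rho>) * (\<Prod>j\<in>J - {i}. 4)"
          using le4 lei \<rho> by (intro mult_mono prod_mono) (auto intro!: prod_nonneg)
        also have "\<dots> = 4 ^ card J * \<rho>"
          unfolding card.remove[OF J i(1)] by simp
        finally show ?thesis .
      qed
      then have "(\<Prod>j\<in>J. (cmod (1 + y j))\<^sup>2) ^ M \<le> (4 ^ card J * \<rho>) ^ M"
        by (intro power_mono prod_nonneg) auto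
      finally show ?thesis by (simp add: power_mult_distrib power_mult)
    qed
    \<comment> \<open>the surviving pairs of monomials\<close>
    define K where "K = {(B, B'). B \<in> X \<and> B' \<in> X \<and> s B = s B'}"
    have "complex_of_real (\<Sum>Q\<in>\<Omega>. (cmod (g Q))\<^sup>2) = (\<Sum>Q\<in>\<Omega>. g Q * cnj (g Q))"
      unfolding of_real_sum complex_norm_square ..
    also have "\<dots> = (\<Sum>Q\<in>\<Omega>. \<Sum>B\<in>X. \<Sum>B'\<in>X. (\<eta> Q (s B) * cnj (\<eta> Q (s B'))) * (cnj (T B) * T B'))"
      unfolding g cnj_sum sum_product by (intro sum.cong refl) (simp add: ac_simps)
    also have "\<dots> = (\<Sum>Q\<in>\<Omega>. \<Sum>x\<in>X \<times> X. \<eta> Q (s (fst x) - s (snd x)) * (cnj (T (fst x)) * T (snd x)))"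
      by (simp add: character_on_diff[OF \<eta>] sum.cartesian_product case_prod_beta)
    also have "\<dots> = (\<Sum>x\<in>X \<times> X. (\<Sum>Q\<in>\<Omega>. \<eta> Q (s (fst x) - s (snd x))) * (cnj (T (fst x)) * T (snd x)))"
      by (subst sum.swap) (simp add: sum_distrib_right)
    also have "\<dots> = (\<Sum>x\<in>X \<times> X. if x \<in> K then of_nat (card \<Omega>) else 0)"
    proof (rule sum.cong[OF refl])
      fix x assume x: "x \<in> X \<times> X"
      then have "s (fst x) - s (snd x) \<in> (\<lambda>(B, B'). s B - s B') ` (X \<times> X)" by force
      note o = orth[OF this]
      show "(\<Sum>Q\<in>\<Omega>. \<eta> Q (s (fst x) - s (snd x))) * (cnj (T (fst x)) * T (snd x))
        = (if x \<in> K then of_nat (card \<Omega>) else 0)"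
      proof (cases "x \<in> K")
        case True
        then have "T (fst x) = T (snd x)" using T[of "fst x" "snd x"] by (auto simp: K_def)
        then have "cnj (T (fst x)) * T (snd x) = 1"
          using T1[of "snd x"] x complex_norm_square[of "T (snd x)"]
          by (metis SigmaE mult.commute of_real_1 one_power2 snd_conv)
        then show ?thesis using o True by (auto simp: K_def)
      next
        case False
        then show ?thesis using o x by (auto simp: K_def)
      qed
    qed
    also have "\<dots> = of_nat (card \<Omega> * card K)"
    proof -
      have "K \<subseteq> X \<times> X" by (auto simp: K_def)
      then have "(X \<times> X) \<inter> K = K" by blast
      then show ?thesis using fX by (simp add: sum.If_cases mult.commute)
    qed
    finally have "(\<Sum>Q\<in>\<Omega>. (cmod (g Q))\<^sup>2) = real (card \<Omega> * card K)"
      by (metis of_real_eq_iff of_real_of_nat_eq)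
    moreover have "(\<Sum>Q\<in>\<Omega>. (cmod (g Q))\<^sup>2) \<le> real (card \<Omega>) * (4 ^ (card J * M) * \<rho> ^ M)"
      using sum_bounded_above[of \<Omega>, OF small] by simp
    ultimately have "real (card \<Omega>) * real (card K) \<le> real (card \<Omega>) * (4 ^ (card J * M) * \<rho> ^ M)"
      by simp
    then have K: "real (card K) \<le> 4 ^ (card J * M) * \<rho> ^ M"
      using \<Omega> by (simp add: card_gt_0_iff)
    have "(card X)\<^sup>2 \<le> card (index_mset ` X) * card {(B, B'). B \<in> X \<and> B' \<in> X \<and> index_mset B = index_mset B'}"
      by (rule card_square_le_collisions[OF fX])
    also have "\<dots> \<le> (M + 1) ^ card J * card K"
    proof (intro mult_mono)
      show "card (index_mset ` X) \<le> (M + 1) ^ card J" unfolding X_def by (rule card_index_msets[OF J])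
      have "s B = s B'" if "index_mset B = index_mset B'" for B B'
        using sum_index_mset[of a B] sum_index_mset[of a B'] that by (simp add: s_def)
      then have "{(B, B'). B \<in> X \<and> B' \<in> X \<and> index_mset B = index_mset B'} \<subseteq> K" unfolding K_def by blast
      moreover have "finite K" by (rule finite_subset[of _ "X \<times> X"]) (auto simp: K_def fX)
      ultimately show "card {(B, B'). B \<in> X \<and> B' \<in> X \<and> index_mset B = index_mset B'} \<le> card K"
        by (rule card_mono[rotated])
    qed auto
    finally have "real ((card X)\<^sup>2) \<le> real ((M + 1) ^ card J * card K)"
      by (rule of_nat_mono)
    also have "\<dots> \<le> real (M + 1) ^ card J * (4 ^ (card J * M) * \<rho> ^ M)"
      using K by (simp add: mult_left_mono)
    also have "real ((card X)\<^sup>2) = 4 ^ (card J * M)"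
    proof -
      have "card X = 2 ^ (card J * M)"
        unfolding X using fP by (simp add: card_Pow P_def card_cartesian_product)
      then show ?thesis by (simp add: power2_eq_square power_mult_distrib[symmetric])
    qed
    finally have "1 \<le> real (M + 1) ^ card J * \<rho> ^ M" by simp
    then show False using M by simp
  qed
  show thesis
  proof (rule that[of "index_mset ` X"])
    show "finite (index_mset ` X)" using fX by simp
    show "set_mset C \<subseteq> J" if "C \<in> index_mset ` X" for C
      using that index_mset_subset[OF _ J] unfolding X_def by blast
  qed (use approx in blast)
qed

section \<open>Selective ultrafilters\<close>

lemma selective_ultrafilterD:
  assumes "selective_ultrafilter p"
  shows "p \<noteq> bot" and "eventually P p \<or> eventually (\<lambda>n. \<not> P n) p"
proof -
  have u: "ultrafilter p"
    using assms by (simp add: selective_ultrafilter_def free_ultrafilter_def)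
  then show "p \<noteq> bot" by (simp add: ultrafilter_def)
  show "eventually P p \<or> eventually (\<lambda>n. \<not> P n) p"
    using u unfolding ultrafilter_def by (auto dest: spec[of _ "{n. P n}"])
qed

lemma not_eventually_not:
  fixes p :: "nat filter"
  assumes "selective_ultrafilter p" "eventually P p" 
  shows "\<not> eventually (\<lambda>n. \<not> P n) p"
proof
  assume "eventually (\<lambda>n. \<not> P n) p"
  with assms(2) have "eventually (\<lambda>n. False) p" by eventually_elim simp
  then show False using selective_ultrafilterD(1)[OF assms(1)] by simp
qed

lemma eventually_ge_selective:
  assumes "selective_ultrafilter p"
  shows "eventually (\<lambda>n. m \<le> n) p"
proof (induction m)
  case (Suc m)
  have "\<not> eventually (\<lambda>n. n = m) p"
  proof
    assume *: "eventually (\<lambda>n. n = m) p"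
    have "p = principal {m}"
    proof (rule filter_eqI)
      fix P show "eventually P p = eventually P (principal {m})"
      proof
        assume "eventually P p"
        then have "eventually (\<lambda>n. P m) p" using * by eventually_elim auto
        then show "eventually P (principal {m})"
          using selective_ultrafilterD(1)[OF assms] by (auto simp: eventually_principal)
      next
        assume "eventually P (principal {m})"
        then show "eventually P p" using * by (auto simp: eventually_principal elim: eventually_mono)
      qed
    qed
    then show False using assms by (auto simp: selective_ultrafilter_def free_ultrafilter_def)
  qed
  then have "eventually (\<lambda>n. n \<noteq> m) p" using selective_ultrafilterD(2)[OF assms] by blast
  with Suc show ?case by eventually_elim auto
qed simp

text \<open>
  The definition of selectivity, applied to the partition into the fibres of \<open>f\<close>.\<close>
lemma selective_transversal:
  fixes f :: "nat \<Rightarrow> nat"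
  assumes p: "selective_ultrafilter p" and f: "\<And>i. \<not> eventually (\<lambda>n. f n = i) p"
  obtains B where "eventually (\<lambda>n. n \<in> B) p" "inj_on f B"
proof -
  define Q where "Q = (\<lambda>n. {m. f m = f n}) ` UNIV"
  have "partition_on UNIV Q" unfolding Q_def by (rule partition_onI) (auto simp: disjnt_def)
  moreover have "\<forall>A\<in>Q. \<not> eventually (\<lambda>n. n \<in> A) p" using f by (auto simp: Q_def)
  ultimately obtain B where B: "eventually (\<lambda>n. n \<in> B) p"
    "\<forall>A\<in>Q. \<forall>m\<in>A \<inter> B. \<forall>n\<in>A \<inter> B. m = n"
    using p unfolding selective_ultrafilter_def by meson
  have "inj_on f B"
  proof (rule inj_onI)
    fix m n assume mn: "m \<in> B" "n \<in> B" "f m = f n"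
    have "{k. f k = f n} \<in> Q" unfolding Q_def by (rule rangeI)
    from bspec[OF B(2) this] have *: "\<forall>m\<in>{k. f k = f n} \<inter> B. \<forall>n'\<in>{k. f k = f n} \<inter> B. m = n'" .
    show "m = n" by (rule *[rule_format]) (use mn in simp_all)
  qed
  with B(1) show thesis by (rule that)
qed

text \<open>
  The Ramsey-like property of selective ultrafilters, obtained by combining two transversals. On
  the first one, for the function \<open>f\<close> counting how many initial conditions
  \<open>n\<close> satisfies, each condition has only finitely many exceptions, bounded by means
  of \<open>N\<close>. The second one picks at most one point from each block of an interval
  partition whose blocks outgrow \<open>N\<close>; a parity restriction separates chosen points by
  a whole block.\<close>
lemma selective_ultrafilter_diagonal:
  assumes p: "selective_ultrafilter p" and C: "\<And>m. eventually (C m) p"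
  obtains B where "eventually (\<lambda>n. n \<in> B) p" "\<And>m n. m \<in> B \<Longrightarrow> n \<in> B \<Longrightarrow> m < n \<Longrightarrow> C m n"
proof -
  define D where "D k n \<longleftrightarrow> k \<le> n \<and> (\<forall>m<k. C m n)" for k n
  have D: "eventually (D k) p" for k
  proof -
    have "eventually (\<lambda>n. \<forall>m\<in>{..<k}. C m n) p" using C by (intro eventually_ball_finite) auto
    with eventually_ge_selective[OF p, of k] show ?thesis by eventually_elim (auto simp: D_def)
  qed
  have D_mono: "D k n" if "D k' n" "k \<le> k'" for k k' n using that by (auto simp: D_def)
  define f where "f n = (GREATEST k. D k n)" for n
  have f1: "D (f n) n" for n
    unfolding f_def by (rule GreatestI_nat[of "\<lambda>k. D k n" 0 n]) (simp_all add: D_def)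
  have f2: "k \<le> f n" if "D k n" for n k
    unfolding f_def by (rule Greatest_le_nat[of "\<lambda>k. D k n" k n, OF that]) (simp add: D_def)
  have "\<not> eventually (\<lambda>n. f n = i) p" for i
  proof -
    have "eventually (\<lambda>n. f n \<noteq> i) p"
      using D[of "Suc i"] by eventually_elim (use f2 not_less_eq_eq in blast)
    then show ?thesis using not_eventually_not[OF p, of "\<lambda>n. f n \<noteq> i"] by simp
  qed
  then obtain B1 where B1: "eventually (\<lambda>n. n \<in> B1) p" "inj_on f B1"
    using selective_transversal[OF p] by blast
  have "finite {n \<in> B1. f n < k}" for k
    by (rule finite_imageD[of f, OF finite_subset[of _ "{..<k}"]])
       (auto intro: inj_on_subset[OF B1(2)])
  then have "\<exists>N. \<forall>n\<in>B1. f n < k \<longrightarrow> n < N" for k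
    using finite_nat_set_iff_bounded[of "{n \<in> B1. f n < k}"] by auto
  then have "\<forall>k. \<exists>N. \<forall>n\<in>B1. f n < k \<longrightarrow> n < N" by blast
  from choice[OF this] obtain N where "\<forall>k. \<forall>n\<in>B1. f n < k \<longrightarrow> n < N k" by blast
  then have N: "k \<le> f n" if "n \<in> B1" "N k \<le> n" for k n
    using that by (meson not_le)
  \<comment> \<open>block boundaries: from \<open>e (Suc i)\<close> on, the conditions of all points up to \<open>e i\<close> hold on \<open>B1\<close>\<close>
  define e where "e = rec_nat 0 (\<lambda>_ x. Suc (x + (\<Sum>k\<le>Suc x. N k)))"
  have e0: "e 0 = 0" and eS: "e (Suc i) = Suc (e i + (\<Sum>k\<le>Suc (e i). N k))" for i
    by (simp_all add: e_def)
  have e_mono: "strict_mono e" by (rule strict_monoI_Suc) (simp add: eS)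
  have e_N: "N (Suc m) \<le> e (Suc i)" if "m \<le> e i" for m i
  proof -
    have "N (Suc m) \<le> (\<Sum>k\<le>Suc (e i). N k)" using that by (intro member_le_sum) auto
    then show ?thesis by (simp add: eS)
  qed
  define blk where "blk n = (LEAST i. n < e (Suc i))" for n
  have ex: "n < e (Suc n)" for n
    using strict_mono_imp_increasing[OF e_mono, of "Suc n"] by simp
  have blk1: "n < e (Suc (blk n))" for n unfolding blk_def by (rule LeastI[of "\<lambda>i. n < e (Suc i)", OF ex])
  have blk2: "e (blk n) \<le> n" for n
  proof (cases "blk n")
    case 0 then show ?thesis by (simp add: e0)
  next
    case (Suc i)
    then have "\<not> n < e (Suc i)" using not_less_Least[of i "\<lambda>i. n < e (Suc i)"] by (simp add: blk_def)
    then show ?thesis using Suc by simp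
  qed
  have "\<not> eventually (\<lambda>n. blk n = i) p" for i
  proof -
    have "eventually (\<lambda>n. blk n \<noteq> i) p"
      using eventually_ge_selective[OF p, of "e (Suc i)"] by eventually_elim (use blk1 leD in blast)
    then show ?thesis using not_eventually_not[OF p, of "\<lambda>n. blk n \<noteq> i"] by simp
  qed
  then obtain B2 where B2: "eventually (\<lambda>n. n \<in> B2) p" "inj_on blk B2"
    using selective_transversal[OF p] by blast
  have "\<exists>par. eventually (\<lambda>n. even (blk n) = par) p"
    using selective_ultrafilterD(2)[OF p, of "\<lambda>n. even (blk n)"]
    by (elim disjE) (rule exI[of _ True], simp, rule exI[of _ False], simp)
  then obtain par where par: "eventually (\<lambda>n. even (blk n) = par) p" by blast
  define B where "B = {n. n \<in> B1 \<and> n \<in> B2 \<and> even (blk n) = par}"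
  show thesis
  proof
    show "eventually (\<lambda>n. n \<in> B) p"
      using B1(1) B2(1) par by eventually_elim (simp add: B_def)
    fix m n assume mn: "m \<in> B" "n \<in> B" "m < n"
    have "blk m \<noteq> blk n" using mn B2(2) by (auto simp: B_def inj_on_def)
    moreover have "\<not> blk n < blk m"
    proof
      assume "blk n < blk m"
      then have "e (Suc (blk n)) \<le> e (blk m)" using e_mono by (simp add: strict_mono_less_eq)
      then show False using blk1[of n] blk2[of m] mn by simp
    qed
    moreover have "even (blk m) = even (blk n)" using mn by (auto simp: B_def)
    ultimately have "Suc (Suc (blk m)) \<le> blk n"
      by presburger
    then have "e (Suc (Suc (blk m))) \<le> n"
      using strict_mono_less_eq[OF e_mono, of "Suc (Suc (blk m))" "blk n"] blk2[of n] by linarith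
    moreover have "N (Suc m) \<le> e (Suc (Suc (blk m)))"
      using blk1[of m] by (intro e_N) simp
    ultimately have "Suc m \<le> f n" using N[of n "Suc m"] mn by (auto simp: B_def)
    then have "D (Suc m) n" using D_mono f1 by blast
    then show "C m n" by (simp add: D_def)
  qed
qed

section \<open>Characters with prescribed limits along a selective ultrafilter\<close>

text \<open>
  In the application below, the left summands stand for constants and the right ones for
  sequences.\<close>
lemma case_sum_mset_split:
  "\<exists>C1 C2. \<forall>(f :: 'a \<Rightarrow> 'c::comm_monoid_add) (g :: 'b \<Rightarrow> 'c) (f' :: 'a \<Rightarrow> 'd::comm_monoid_mult) (g' :: 'b \<Rightarrow> 'd).
     (\<Sum>j\<in>#C. case_sum f g j) = (\<Sum>s\<in>#C1. f s) + (\<Sum>k\<in>#C2. g k) \<and>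
     (\<Prod>j\<in>#C. case_sum f' g' j) = (\<Prod>s\<in>#C1. f' s) * (\<Prod>k\<in>#C2. g' k)"
proof (induction C)
  case empty
  then show ?case by (intro exI[of _ "{#}"]) simp
next
  case (add j C)
  then obtain C1 C2 where IH: "\<forall>(f :: 'a \<Rightarrow> 'c) (g :: 'b \<Rightarrow> 'c) (f' :: 'a \<Rightarrow> 'd) (g' :: 'b \<Rightarrow> 'd).
     (\<Sum>j\<in>#C. case_sum f g j) = (\<Sum>s\<in>#C1. f s) + (\<Sum>k\<in>#C2. g k) \<and>
     (\<Prod>j\<in>#C. case_sum f' g' j) = (\<Prod>s\<in>#C1. f' s) * (\<Prod>k\<in>#C2. g' k)" by blast
  show ?case
  proof (cases j)
    case (Inl s)
    then show ?thesis using IH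
      by (intro exI[of _ "add_mset s C1"] exI[of _ C2]) (simp add: ac_simps)
  next
    case (Inr k)
    then show ?thesis using IH
      by (intro exI[of _ C1] exI[of _ "add_mset k C2"]) (simp add: ac_simps)
  qed
qed

text \<open>
  Only finitely many relations matter for the Kronecker approximation at \<open>S\<close> and
  \<open>v 0 n, \<dots>, v m n\<close>, and each of them holds either for \<open>p\<close>-many or
  for \<open>p\<close>-almost no \<open>n\<close>. One that holds for \<open>p\<close>-many
  \<open>n\<close> says that a combination of the sequences is \<open>p\<close>-essentially equal
  to a combination of elements of \<open>S\<close>, so by \<open>indep\<close> it splits into a
  relation inside \<open>S\<close>, which every character respects, and one respected by
  \<open>t\<close>.\<close>
lemma eventually_approximable:
  fixes v :: "nat \<Rightarrow> nat \<Rightarrow> 'a::ab_group_add" and t :: "nat \<Rightarrow> complex"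
  assumes sep: "\<And>v::'a. v \<noteq> 0 \<Longrightarrow> \<exists>\<psi>. character_on UNIV \<psi> \<and> \<psi> v = - 1"
    and p: "selective_ultrafilter p"
    and t: "\<And>k. cmod (t k) = 1"
    and indep: "\<And>C D a. eventually (\<lambda>n. (\<Sum>k\<in>#C. v k n) - (\<Sum>k\<in>#D. v k n) = a) p \<Longrightarrow>
                  a = 0 \<and> (\<Prod>k\<in>#C. t k) = (\<Prod>k\<in>#D. t k)"
    and S: "finite S" and \<epsilon>: "\<epsilon> > 0"
  shows "eventually (\<lambda>n. \<forall>\<phi>. character_on UNIV \<phi> \<longrightarrow>
           (\<exists>\<phi>'. character_on UNIV \<phi>' \<and> (\<forall>s\<in>S. cmod (\<phi>' s - \<phi> s) < \<epsilon>) \<and>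
                 (\<forall>k\<le>m. cmod (\<phi>' (v k n) - t k) < \<epsilon>))) p"
proof -
  define J where "J = Inl ` S \<union> Inr ` {..m}"
  have J: "finite J" using S by (simp add: J_def)
  obtain \<C> where fin: "finite \<C>"
    and K: "\<And>(a::'a + nat \<Rightarrow> 'a) t. (\<And>j. j \<in> J \<Longrightarrow> cmod (t j) = 1) \<Longrightarrow>
       (\<And>C D. C \<in> \<C> \<Longrightarrow> D \<in> \<C> \<Longrightarrow> (\<Sum>j\<in>#C. a j) = (\<Sum>j\<in>#D. a j) \<Longrightarrow>
          (\<Prod>j\<in>#C. t j) = (\<Prod>j\<in>#D. t j)) \<Longrightarrow>
       \<exists>\<phi>. character_on UNIV \<phi> \<and> (\<forall>j\<in>J. cmod (\<phi> (a j) - t j) < \<epsilon>)"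
    using kronecker_approximation[OF sep J \<epsilon>] by metis
  define a where "a n = case_sum (\<lambda>s. s) (\<lambda>k. v k n)" for n
  define T where "T \<phi> = case_sum \<phi> t" for \<phi> :: "'a \<Rightarrow> complex"
  have "eventually (\<lambda>n. (\<Sum>j\<in>#C. a n j) = (\<Sum>j\<in>#D. a n j) \<longrightarrow>
          (\<forall>\<phi>. character_on UNIV \<phi> \<longrightarrow> (\<Prod>j\<in>#C. T \<phi> j) = (\<Prod>j\<in>#D. T \<phi> j))) p" for C D
  proof (cases "eventually (\<lambda>n. (\<Sum>j\<in>#C. a n j) \<noteq> (\<Sum>j\<in>#D. a n j)) p")
    case True
    then show ?thesis by eventually_elim simp
  next
    case False
    then have ev: "eventually (\<lambda>n. (\<Sum>j\<in>#C. a n j) = (\<Sum>j\<in>#D. a n j)) p"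
      using selective_ultrafilterD(2)[OF p, of "\<lambda>n. (\<Sum>j\<in>#C. a n j) = (\<Sum>j\<in>#D. a n j)"] by blast
    obtain C1 C2 where C: "\<forall>(f :: 'a \<Rightarrow> 'a) (g :: nat \<Rightarrow> 'a) (f' :: 'a \<Rightarrow> complex) g'.
     (\<Sum>j\<in>#C. case_sum f g j) = (\<Sum>s\<in>#C1. f s) + (\<Sum>k\<in>#C2. g k) \<and>
     (\<Prod>j\<in>#C. case_sum f' g' j) = (\<Prod>s\<in>#C1. f' s) * (\<Prod>k\<in>#C2. g' k)"
      using case_sum_mset_split[of C] by blast
    obtain D1 D2 where D: "\<forall>(f :: 'a \<Rightarrow> 'a) (g :: nat \<Rightarrow> 'a) (f' :: 'a \<Rightarrow> complex) g'.
     (\<Sum>j\<in>#D. case_sum f g j) = (\<Sum>s\<in>#D1. f s) + (\<Sum>k\<in>#D2. g k) \<and>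
     (\<Prod>j\<in>#D. case_sum f' g' j) = (\<Prod>s\<in>#D1. f' s) * (\<Prod>k\<in>#D2. g' k)"
      using case_sum_mset_split[of D] by blast
    from ev have "eventually (\<lambda>n. (\<Sum>k\<in>#C2. v k n) - (\<Sum>k\<in>#D2. v k n) = (\<Sum>s\<in>#D1. s) - (\<Sum>s\<in>#C1. s)) p"
      by eventually_elim (use C D in \<open>simp add: a_def algebra_simps\<close>)
    from indep[OF this] have eq: "(\<Sum>s\<in>#D1. s) = (\<Sum>s\<in>#C1. s)" "(\<Prod>k\<in>#C2. t k) = (\<Prod>k\<in>#D2. t k)"
      by auto
    have "(\<Prod>j\<in>#C. T \<phi> j) = (\<Prod>j\<in>#D. T \<phi> j)" if \<phi>: "character_on UNIV \<phi>" for \<phi>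
    proof -
      have "(\<Prod>s\<in>#C1. \<phi> s) = (\<Prod>s\<in>#D1. \<phi> s)"
        using character_on_sum_mset[OF \<phi>, of "\<lambda>s. s" C1] character_on_sum_mset[OF \<phi>, of "\<lambda>s. s" D1] eq(1)
        by simp
      then show ?thesis using C D eq(2) by (simp add: T_def)
    qed
    then show ?thesis by simp
  qed
  then have "eventually (\<lambda>n. \<forall>C\<in>\<C>. \<forall>D\<in>\<C>. (\<Sum>j\<in>#C. a n j) = (\<Sum>j\<in>#D. a n j) \<longrightarrow>
          (\<forall>\<phi>. character_on UNIV \<phi> \<longrightarrow> (\<Prod>j\<in>#C. T \<phi> j) = (\<Prod>j\<in>#D. T \<phi> j))) p"
    using fin by (intro eventually_ball_finite ballI)
  then show ?thesis
  proof eventually_elim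
    case (elim n)
    show ?case
    proof (intro allI impI)
      fix \<phi> :: "'a \<Rightarrow> complex" assume \<phi>: "character_on UNIV \<phi>"
      have "cmod (T \<phi> j) = 1" for j
        using t character_onD(1)[OF \<phi>] by (cases j) (auto simp: T_def)
      then obtain \<phi>' where \<phi>': "character_on UNIV \<phi>'" "\<forall>j\<in>J. cmod (\<phi>' (a n j) - T \<phi> j) < \<epsilon>"
        using K[of "T \<phi>" "a n"] elim \<phi> by blast
      have "cmod (\<phi>' s - \<phi> s) < \<epsilon>" if "s \<in> S" for s
        using bspec[OF \<phi>'(2), of "Inl s"] that by (simp add: J_def a_def T_def)
      moreover have "cmod (\<phi>' (v k n) - t k) < \<epsilon>" if "k \<le> m" for k
        using bspec[OF \<phi>'(2), of "Inr k"] that by (simp add: J_def a_def T_def)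
      ultimately show "\<exists>\<phi>'. character_on UNIV \<phi>' \<and> (\<forall>s\<in>S. cmod (\<phi>' s - \<phi> s) < \<epsilon>) \<and>
                 (\<forall>k\<le>m. cmod (\<phi>' (v k n) - t k) < \<epsilon>)" using \<phi>'(1) by blast
    qed
  qed
qed

lemma geometric_steps_converge:
  fixes x :: "nat \<Rightarrow> complex"
  assumes step: "\<And>i. i0 \<le> i \<Longrightarrow> cmod (x (Suc i) - x i) \<le> (1/2) ^ i"
  shows "\<exists>l. x \<longlonglongrightarrow> l \<and> (\<forall>i\<ge>i0. cmod (l - x i) \<le> 2 * (1/2) ^ i)"
proof -
  have bound: "cmod (x (i + k) - x i) \<le> 2 * (1/2) ^ i - 2 * (1/2) ^ (i + k)" if "i0 \<le> i" for i k
  proof (induction k)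
    case (Suc k)
    have "cmod (x (i + Suc k) - x i) \<le> cmod (x (Suc (i + k)) - x (i + k)) + cmod (x (i + k) - x i)"
      using norm_triangle_ineq[of "x (Suc (i + k)) - x (i + k)" "x (i + k) - x i"] by simp
    also have "\<dots> \<le> (1/2) ^ (i + k) + (2 * (1/2) ^ i - 2 * (1/2) ^ (i + k))"
      using Suc step[of "i + k"] that by (intro add_mono) auto
    finally show ?case by simp
  qed simp
  have le: "cmod (x j - x i) \<le> 2 * (1/2) ^ i" if "i0 \<le> i" "i \<le> j" for i j
  proof -
    have "cmod (x j - x i) \<le> 2 * (1/2) ^ i - 2 * (1/2) ^ j"
      using bound[OF that(1), of "j - i"] that(2) by simp
    moreover have "0 \<le> 2 * (1/2::real) ^ j" by simp
    ultimately show ?thesis by linarith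
  qed
  have "Cauchy x"
  proof (rule CauchyI)
    fix e :: real assume e: "0 < e"
    obtain M where M: "(1/2::real) ^ M < e / 4"
      using real_arch_pow_inv[of "e / 4" "1/2"] e by auto
    define N where "N = max M i0"
    have "(1/2::real) ^ N \<le> (1/2) ^ M" by (intro power_decreasing) (auto simp: N_def)
    with M have N: "4 * (1/2::real) ^ N < e" by linarith
    show "\<exists>M. \<forall>m\<ge>M. \<forall>n\<ge>M. cmod (x m - x n) < e"
    proof (intro exI[of _ N] allI impI)
      fix m n assume "N \<le> m" "N \<le> n"
      then have "cmod (x m - x N) \<le> 2 * (1/2) ^ N" "cmod (x n - x N) \<le> 2 * (1/2) ^ N"
        using le[of N] by (auto simp: N_def)
      then show "cmod (x m - x n) < e"
        using norm_triangle_ineq4[of "x m - x N" "x n - x N"] N by simp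
    qed
  qed
  then obtain l where l: "x \<longlonglongrightarrow> l" using Cauchy_convergent convergent_def by blast
  have "cmod (l - x i) \<le> 2 * (1/2) ^ i" if "i0 \<le> i" for i
  proof (rule tendsto_upperbound)
    show "(\<lambda>j. cmod (x j - x i)) \<longlonglongrightarrow> cmod (l - x i)"
      by (intro tendsto_intros l)
    show "eventually (\<lambda>j. cmod (x j - x i) \<le> 2 * (1/2) ^ i) sequentially"
      using eventually_ge_at_top[of i] by eventually_elim (rule le[OF that])
  qed simp
  with l show ?thesis by blast
qed

text \<open>
  The set \<open>B\<close> of the diagonal lemma is enumerated as \<open>b 0 < b 1 <
  \<dots>\<close>, and a sequence of characters is built in which step \<open>i\<close> brings the
  values of \<open>v k (b (Suc i))\<close> close to \<open>t k\<close> and moves the values at the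
  finitely many elements considered before by at most \<open>(1/2) ^ b i\<close>. Pointwise limits
  on \<open>H\<close> exist and inherit the approximations.

  The hypothesis \<open>indep\<close> says that no combination of the sequences is
  \<open>p\<close>-essentially equal to a non-zero constant and that the targets respect all
  relations that hold \<open>p\<close>-essentially. Some such condition on constants is natural,
  since the value of \<open>\<phi>\<close> at a constant would otherwise be prescribed exactly.\<close>
lemma character_interpolation:
  fixes v :: "nat \<Rightarrow> nat \<Rightarrow> 'a::ab_group_add" and t :: "nat \<Rightarrow> complex"
  assumes sep: "\<And>v::'a. v \<noteq> 0 \<Longrightarrow> \<exists>\<psi>. character_on UNIV \<psi> \<and> \<psi> v = - 1"
    and p: "selective_ultrafilter p"
    and H: "countable H" "\<And>a b. a \<in> H \<Longrightarrow> b \<in> H \<Longrightarrow> a + b \<in> H" "\<And>k n. v k n \<in> H"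
    and t: "\<And>k. cmod (t k) = 1"
    and indep: "\<And>C D a. eventually (\<lambda>n. (\<Sum>k\<in>#C. v k n) - (\<Sum>k\<in>#D. v k n) = a) p \<Longrightarrow>
                  a = 0 \<and> (\<Prod>k\<in>#C. t k) = (\<Prod>k\<in>#D. t k)"
  shows "\<exists>\<phi>. character_on H \<phi> \<and> (\<forall>k. ((\<lambda>n. \<phi> (v k n)) \<longlongrightarrow> t k) p)"
proof -
  have Hne: "H \<noteq> {}" using H(3) by blast
  define e where "e = from_nat_into H"
  have e: "range e = H" unfolding e_def using H(1) Hne by (simp add: range_from_nat_into)
  define S where "S m = e ` {..m} \<union> (\<lambda>(k, i). v k i) ` ({..m} \<times> {..m})" for m
  have S_mono: "S m \<subseteq> S n" if "m \<le> n" for m n using that by (fastforce simp: S_def)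
  define good where "good m n \<longleftrightarrow> (\<forall>\<phi>. character_on UNIV \<phi> \<longrightarrow>
           (\<exists>\<phi>'. character_on UNIV \<phi>' \<and> (\<forall>s\<in>S m. cmod (\<phi>' s - \<phi> s) < (1/2) ^ m) \<and>
                 (\<forall>k\<le>m. cmod (\<phi>' (v k n) - t k) < (1/2) ^ m)))" for m n
  have "eventually (good m) p" for m
    unfolding good_def by (rule eventually_approximable[OF sep p t indep]) (auto simp: S_def)
  then obtain B where B: "eventually (\<lambda>n. n \<in> B) p" "\<And>m n. m \<in> B \<Longrightarrow> n \<in> B \<Longrightarrow> m < n \<Longrightarrow> good m n"
    using selective_ultrafilter_diagonal[OF p, of good] by blast
  have "infinite B"
  proof
    assume "finite B"
    then obtain N where "\<forall>n\<in>B. n < N" using finite_nat_set_iff_bounded by blast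
    then have "eventually (\<lambda>n. n < N) p" using B(1) by (auto elim: eventually_mono)
    then show False using not_eventually_not[OF p, of "\<lambda>n. n < N"] eventually_ge_selective[OF p, of N] by (simp add: not_less)
  qed
  define b where "b = enumerate B"
  have b: "strict_mono b" "range b = B"
    using \<open>infinite B\<close> by (auto simp: b_def strict_mono_enumerate range_enumerate)
  have b_ge: "i \<le> b i" for i using strict_mono_imp_increasing[OF b(1)] .
  have pow: "(1/2::real) ^ b i \<le> (1/2) ^ i" for i using b_ge by (intro power_decreasing) auto
  have "\<exists>\<phi>. \<forall>i. character_on UNIV (\<phi> i) \<and> (\<forall>s\<in>S (b i). cmod (\<phi> (Suc i) s - \<phi> i s) < (1/2) ^ b i) \<and>
      (\<forall>k\<le>b i. cmod (\<phi> (Suc i) (v k (b (Suc i))) - t k) < (1/2) ^ b i)"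
    proof (rule dependent_nat_choice[of "\<lambda>_. character_on UNIV" "\<lambda>i \<phi> \<phi>'.
        (\<forall>s\<in>S (b i). cmod (\<phi>' s - \<phi> s) < (1/2) ^ b i) \<and>
        (\<forall>k\<le>b i. cmod (\<phi>' (v k (b (Suc i))) - t k) < (1/2) ^ b i)"])
      show "\<exists>\<phi> :: 'a \<Rightarrow> complex. character_on UNIV \<phi>"
        by (rule exI[of _ "\<lambda>_. 1"]) (simp add: character_on_def)
      fix \<phi> :: "'a \<Rightarrow> complex" and i assume "character_on UNIV \<phi>"
      moreover have "good (b i) (b (Suc i))"
        using b by (intro B(2)) (auto simp: strict_mono_def)
      ultimately show "\<exists>\<phi>'. character_on UNIV \<phi>' \<and> (\<forall>s\<in>S (b i). cmod (\<phi>' s - \<phi> s) < (1/2) ^ b i) \<and>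
        (\<forall>k\<le>b i. cmod (\<phi>' (v k (b (Suc i))) - t k) < (1/2) ^ b i)"
        unfolding good_def by blast
    qed
  then obtain \<Phi> where \<Phi>: "\<And>i. character_on UNIV (\<Phi> i)"
    and near: "\<And>i s. s \<in> S (b i) \<Longrightarrow> cmod (\<Phi> (Suc i) s - \<Phi> i s) < (1/2) ^ b i"
    and hit: "\<And>i k. k \<le> b i \<Longrightarrow> cmod (\<Phi> (Suc i) (v k (b (Suc i))) - t k) < (1/2) ^ b i"
    by blast
  have lim: "\<exists>l. (\<lambda>j. \<Phi> j s) \<longlonglongrightarrow> l \<and> (\<forall>j\<ge>i. cmod (l - \<Phi> j s) \<le> 2 * (1/2) ^ j)"
    if "s \<in> S (b i)" for s i
  proof (rule geometric_steps_converge)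
    fix j assume "i \<le> j"
    then have "s \<in> S (b j)"
      using that S_mono[of "b i" "b j"] b(1) by (auto simp: strict_mono_less_eq)
    from near[OF this] pow[of j] show "cmod (\<Phi> (Suc j) s - \<Phi> j s) \<le> (1/2) ^ j" by linarith
  qed
  define \<phi> where "\<phi> s = lim (\<lambda>j. \<Phi> j s)" for s
  have \<phi>: "(\<lambda>j. \<Phi> j s) \<longlonglongrightarrow> \<phi> s \<and> (\<forall>j\<ge>i. cmod (\<phi> s - \<Phi> j s) \<le> 2 * (1/2) ^ j)"
    if "s \<in> S (b i)" for s i
    using lim[OF that] limI unfolding \<phi>_def by metis
  have conv: "(\<lambda>j. \<Phi> j s) \<longlonglongrightarrow> \<phi> s" if s: "s \<in> H" for s
  proof -
    obtain i where "s = e i" using s e by blast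
    then have "s \<in> S (b i)" using b_ge[of i] by (auto simp: S_def)
    then show ?thesis using \<phi> by blast
  qed
  have "character_on H \<phi>"
    unfolding character_on_def
  proof (intro conjI ballI)
    fix a assume a: "a \<in> H"
    have "(\<lambda>j. cmod (\<Phi> j a)) \<longlonglongrightarrow> cmod (\<phi> a)" using conv[OF a] by (rule tendsto_norm)
    moreover have "(\<lambda>j. cmod (\<Phi> j a)) \<longlonglongrightarrow> 1" using character_onD(1)[OF \<Phi>] by simp
    ultimately show "cmod (\<phi> a) = 1" by (rule LIMSEQ_unique)
    fix b assume b: "b \<in> H"
    have "(\<lambda>j. \<Phi> j a * \<Phi> j b) \<longlonglongrightarrow> \<phi> a * \<phi> b" using conv[OF a] conv[OF b] by (rule tendsto_mult)
    moreover have "(\<lambda>j. \<Phi> j a * \<Phi> j b) \<longlonglongrightarrow> \<phi> (a + b)"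
      using conv[OF H(2)[OF a b]] character_onD(2)[OF \<Phi>] by simp
    ultimately show "\<phi> (a + b) = \<phi> a * \<phi> b" by (rule LIMSEQ_unique[symmetric])
  qed
  moreover have "((\<lambda>n. \<phi> (v k n)) \<longlongrightarrow> t k) p" for k
  proof (rule tendstoI)
    fix r :: real assume r: "0 < r"
    obtain M where M: "(1/2::real) ^ M < r / 2"
      using real_arch_pow_inv[of "r / 2" "1/2"] r by auto
    define N where "N = max M k"
    have "(1/2::real) ^ N \<le> (1/2) ^ M" by (intro power_decreasing) (auto simp: N_def)
    with M have N: "2 * (1/2::real) ^ N < r" by linarith
    have "eventually (\<lambda>n. n \<in> B \<and> b (Suc N) \<le> n) p"
      using B(1) eventually_ge_selective[OF p] by (rule eventually_conj)
    then show "eventually (\<lambda>n. dist (\<phi> (v k n)) (t k) < r) p"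
    proof eventually_elim
      case (elim n)
      then obtain j where "n = b j" using b(2) by blast
      with elim have "Suc N \<le> j" using b(1) by (simp add: strict_mono_less_eq)
      then obtain i where i: "n = b (Suc i)" "N \<le> i" using \<open>n = b j\<close> by (cases j) auto
      have ki: "k \<le> b i" using i(2) b_ge[of i] by (simp add: N_def)
      then have "k \<le> n" using b(1) i(1) by (meson le_trans lessI less_imp_le strict_monoD)
      then have "v k n \<in> S (b (Suc i))" unfolding i(1)[symmetric] S_def by force
      then have "cmod (\<phi> (v k n) - \<Phi> (Suc i) (v k n)) \<le> 2 * (1/2) ^ Suc i" using \<phi> by blast
      moreover have "cmod (\<Phi> (Suc i) (v k n) - t k) < (1/2) ^ i"
        using hit[OF ki] pow[of i] unfolding i(1) by linarith
      ultimately have "cmod (\<phi> (v k n) - t k) < 2 * (1/2) ^ i"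
        using norm_triangle_ineq[of "\<phi> (v k n) - \<Phi> (Suc i) (v k n)" "\<Phi> (Suc i) (v k n) - t k"] by simp
      also have "\<dots> \<le> 2 * (1/2) ^ N" using i(2) by (intro mult_left_mono power_decreasing) auto
      finally show ?case using N by (simp add: dist_norm)
    qed
  qed
  ultimately show ?thesis by blast
qed

section \<open>Finitely supported functions, countable sets and cardinals\<close>

definition graph :: "('k \<Rightarrow>\<^sub>0 rat) \<Rightarrow> ('k \<times> rat) set" where
  "graph a = (\<lambda>\<mu>. (\<mu>, Poly_Mapping.lookup a \<mu>)) ` Poly_Mapping.keys a"

lemma inj_graph: "inj graph"
proof (rule injI)
  fix a b :: "'k \<Rightarrow>\<^sub>0 rat" assume eq: "graph a = graph b"
  have *: "(\<mu>, q) \<in> graph c \<longleftrightarrow> Poly_Mapping.lookup c \<mu> = q" if "q \<noteq> 0" for c :: "'k \<Rightarrow>\<^sub>0 rat" and \<mu> q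
    using that by (auto simp: graph_def in_keys_iff)
  show "a = b"
  proof (rule poly_mapping_eqI)
    fix \<mu>
    show "Poly_Mapping.lookup a \<mu> = Poly_Mapping.lookup b \<mu>"
      using *[of "Poly_Mapping.lookup a \<mu>" \<mu> a] *[of "Poly_Mapping.lookup a \<mu>" \<mu> b]
        *[of "Poly_Mapping.lookup b \<mu>" \<mu> a] *[of "Poly_Mapping.lookup b \<mu>" \<mu> b] eq
      by (cases "Poly_Mapping.lookup a \<mu> = 0"; cases "Poly_Mapping.lookup b \<mu> = 0") simp_all
  qed
qed

lemma countable_supported_in:
  assumes "countable E"
  shows "countable {a :: 'k \<Rightarrow>\<^sub>0 rat. Poly_Mapping.keys a \<subseteq> E}"
proof -
  have "countable {F. finite F \<and> F \<subseteq> E \<times> (UNIV :: rat set)}"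
    by (intro countable_Collect_finite_subset countable_SIGMA assms) auto
  moreover have "graph ` {a. Poly_Mapping.keys a \<subseteq> E} \<subseteq> {F. finite F \<and> F \<subseteq> E \<times> (UNIV :: rat set)}"
    by (auto simp: graph_def)
  ultimately have "countable (graph ` {a. Poly_Mapping.keys a \<subseteq> E})" by (rule countable_subset[rotated])
  then show ?thesis using countable_image_inj_on inj_graph inj_on_subset by blast
qed

text \<open>
  The hypothesis on \<open>\<kappa>\<close> is used in two ways: there are only
  \<open>\<kappa>\<close> many sequences in the direct sum, and countable subsets of
  \<open>\<kappa>\<close> are bounded.\<close>
locale countably_closed_cardinal =
  fixes \<kappa> :: "'k rel"
  assumes Card: "Card_order \<kappa>" and inf: "infinite (Field \<kappa>)"
    and pow: "ordIso2 \<kappa> (BNF_Cardinal_Arithmetic.cexp \<kappa> natLeq)"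
begin

lemma sequence_coding:
  obtains \<Theta> :: "(nat \<Rightarrow> 'k) \<Rightarrow> 'k" where
    "inj_on \<Theta> {f. range f \<subseteq> Field \<kappa>}" "\<And>f. range f \<subseteq> Field \<kappa> \<Longrightarrow> \<Theta> f \<in> Field \<kappa>"
proof -
  have "ordIso2 (card_of (Func (UNIV :: nat set) (Field \<kappa>))) \<kappa>"
    using pow unfolding cexp_def Field_natLeq by (rule ordIso_symmetric)
  then have "ordIso2 (card_of (Func (UNIV :: nat set) (Field \<kappa>))) (card_of (Field \<kappa>))"
    using card_of_Field_ordIso[OF Card] ordIso_symmetric ordIso_transitive by blast
  then obtain \<Theta> where \<Theta>: "bij_betw \<Theta> (Func (UNIV :: nat set) (Field \<kappa>)) (Field \<kappa>)"
    using card_of_ordIso by blast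
  have eq: "Func (UNIV :: nat set) (Field \<kappa>) = {f. range f \<subseteq> Field \<kappa>}"
    by (auto simp: Func_def)
  show thesis
  proof (rule that)
    show "inj_on \<Theta> {f. range f \<subseteq> Field \<kappa>}"
      using bij_betw_imp_inj_on[OF \<Theta>] unfolding eq .
    show "\<Theta> f \<in> Field \<kappa>" if "range f \<subseteq> Field \<kappa>" for f
      using bij_betwE[OF \<Theta>] that unfolding eq by blast
  qed
qed

lemma wo: "wo_rel \<kappa>"
  using Card by (simp add: card_order_on_def wo_rel_def)

lemma no_injection_into_initial_segment:
  assumes "inj_on f (Field \<kappa>)" "f ` Field \<kappa> \<subseteq> underS \<kappa> a" "a \<in> Field \<kappa>"
  shows False
proof -
  have "ordLeq3 (card_of (Field \<kappa>)) (card_of (underS \<kappa> a))" using assms card_of_ordLeqI by blast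
  moreover have "ordLess2 (card_of (underS \<kappa> a)) \<kappa>" by (rule card_of_underS[OF Card assms(3)])
  ultimately have "ordLess2 (card_of (Field \<kappa>)) \<kappa>" by (rule ordLeq_ordLess_trans)
  then show False
    using card_of_Field_ordIso[OF Card] not_ordLess_ordIso by blast
qed

lemma underS_total:
  assumes "a \<in> Field \<kappa>" "b \<in> Field \<kappa>" "b \<notin> underS \<kappa> a"
  shows "(a, b) \<in> \<kappa>"
proof -
  have "(a, b) \<in> \<kappa> \<or> (b, a) \<in> \<kappa>" using wo_rel.TOTALS[OF wo] assms(1,2) by blast
  moreover have "(b, b) \<in> \<kappa>" using wo_rel.REFL[OF wo] assms(2) by (rule refl_onD)
  ultimately show ?thesis using assms(3) unfolding underS_def by blast
qed

lemma under_subset_underS: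
  assumes "(a, b) \<in> \<kappa>" "a \<noteq> b" "(c, a) \<in> \<kappa>"
  shows "c \<in> underS \<kappa> b"
proof -
  have "(c, b) \<in> \<kappa>" by (rule transD[OF wo_rel.TRANS[OF wo] assms(3,1)])
  moreover have "c \<noteq> b" using antisymD[OF wo_rel.ANTISYM[OF wo] assms(1)] assms(2,3) by blast
  ultimately show ?thesis by (simp add: underS_def)
qed

lemma underS_mono:
  assumes "(a, b) \<in> \<kappa>"
  shows "underS \<kappa> a \<subseteq> underS \<kappa> b"
  using under_subset_underS[OF assms] by (cases "a = b") (auto simp: underS_def)

text \<open>
  Koenig's diagonal argument: if a sequence \<open>s\<close> were cofinal, then
  \<open>\<kappa>\<close> would be the union of initial segments up to \<open>s n\<close>, and,
  each of these being of size less than \<open>\<kappa>\<close>, a sequence \<open>g\<close> could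
  be chosen that differs at place \<open>n\<close> from all sequences coded by points up to
  \<open>s n\<close>.\<close>
lemma countable_strictly_bounded:
  assumes "countable S" "S \<subseteq> Field \<kappa>"
  obtains \<xi> where "\<xi> \<in> Field \<kappa>" "S \<subseteq> underS \<kappa> \<xi>"
proof (rule ccontr)
  assume neg: "\<not> thesis"
  have unb: "\<exists>s\<in>S. s \<notin> underS \<kappa> \<xi>" if "\<xi> \<in> Field \<kappa>" for \<xi>
    using neg that(1) \<open>\<And>\<xi>. \<xi> \<in> Field \<kappa> \<Longrightarrow> S \<subseteq> underS \<kappa> \<xi> \<Longrightarrow> thesis\<close> by blast
  obtain \<xi>0 where "\<xi>0 \<in> Field \<kappa>" using inf not_finite_existsD[of "\<lambda>x. x \<in> Field \<kappa>"] by auto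
  then have "S \<noteq> {}" using unb by blast
  define s where "s = from_nat_into S"
  have s: "range s = S" unfolding s_def using assms(1) \<open>S \<noteq> {}\<close> by (rule range_from_nat_into[rotated])
  have sF: "s n \<in> Field \<kappa>" for n using s assms(2) by blast
  have cover: "\<exists>n. (\<xi>, s n) \<in> \<kappa>" if \<xi>: "\<xi> \<in> Field \<kappa>" for \<xi>
  proof -
    obtain s' where s': "s' \<in> S" "s' \<notin> underS \<kappa> \<xi>" using unb[OF \<xi>] by blast
    then obtain n where "s' = s n" using s by blast
    with underS_total[OF \<xi> sF, of n] s' show ?thesis by blast
  qed
  obtain \<Theta> :: "(nat \<Rightarrow> 'k) \<Rightarrow> 'k" where \<Theta>: "inj_on \<Theta> {f. range f \<subseteq> Field \<kappa>}" "\<And>f. range f \<subseteq> Field \<kappa> \<Longrightarrow> \<Theta> f \<in> Field \<kappa>"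
    using sequence_coding by blast
  define F where "F = inv_into {f. range f \<subseteq> Field \<kappa>} \<Theta>"
  have F: "F (\<Theta> f) = f" if "range f \<subseteq> Field \<kappa>" for f
    unfolding F_def using \<Theta>(1) that by (simp add: inv_into_f_f)
  have "\<exists>g\<in>Field \<kappa>. \<forall>\<alpha>. (\<alpha>, s n) \<in> \<kappa> \<longrightarrow> F \<alpha> n \<noteq> g" for n
  proof (rule ccontr)
    assume "\<not> ?thesis"
    then have "\<forall>g\<in>Field \<kappa>. \<exists>\<alpha>. (\<alpha>, s n) \<in> \<kappa> \<and> F \<alpha> n = g" by blast
    from bchoice[OF this] obtain c where "\<forall>g\<in>Field \<kappa>. (c g, s n) \<in> \<kappa> \<and> F (c g) n = g" ..
    then have c: "(c g, s n) \<in> \<kappa>" "F (c g) n = g" if "g \<in> Field \<kappa>" for g using that by simp_all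
    obtain b where b: "b \<in> Field \<kappa>" "s n \<noteq> b" "(s n, b) \<in> \<kappa>"
      using infinite_Card_order_limit[OF Card inf sF] by blast
    have "c g \<in> underS \<kappa> b" if "g \<in> Field \<kappa>" for g
      by (rule under_subset_underS[OF b(3,2) c(1)[OF that]])
    then have "c ` Field \<kappa> \<subseteq> underS \<kappa> b" by (rule image_subsetI)
    moreover have "inj_on c (Field \<kappa>)" by (rule inj_on_inverseI[of _ "\<lambda>a. F a n"]) (rule c(2))
    ultimately show False using no_injection_into_initial_segment b(1) by blast
  qed
  then have "\<forall>n. \<exists>g. g \<in> Field \<kappa> \<and> (\<forall>\<alpha>. (\<alpha>, s n) \<in> \<kappa> \<longrightarrow> F \<alpha> n \<noteq> g)" by blast
  from choice[OF this] obtain g where "\<forall>n. g n \<in> Field \<kappa> \<and> (\<forall>\<alpha>. (\<alpha>, s n) \<in> \<kappa> \<longrightarrow> F \<alpha> n \<noteq> g n)" ..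
  then have g: "g n \<in> Field \<kappa>" "(\<alpha>, s n) \<in> \<kappa> \<Longrightarrow> F \<alpha> n \<noteq> g n" for n \<alpha> by simp_all
  have rg: "range g \<subseteq> Field \<kappa>" using g(1) by blast
  obtain n where "(\<Theta> g, s n) \<in> \<kappa>" using cover[OF \<Theta>(2)[OF rg]] by blast
  from g(2)[OF this] F[OF rg] show False by simp
qed

text \<open>
  For each \<open>f\<close> there are \<open>\<kappa>\<close> many codes of pairs \<open>(e f,
  \<beta>)\<close>, so one of them lies above the countable set \<open>s f\<close>; the first
  component keeps the choices for different \<open>f\<close> apart.\<close>
lemma index_above:
  assumes e: "inj_on e B" "e ` B \<subseteq> Field \<kappa>"
    and s: "\<And>f. f \<in> B \<Longrightarrow> countable (s f) \<and> s f \<subseteq> Field \<kappa>"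
  obtains \<iota> where "inj_on \<iota> B" "\<And>f. f \<in> B \<Longrightarrow> \<iota> f \<in> Field \<kappa> \<and> s f \<subseteq> underS \<kappa> (\<iota> f)"
proof -
  obtain \<Theta> :: "(nat \<Rightarrow> 'k) \<Rightarrow> 'k" where \<Theta>: "inj_on \<Theta> {f. range f \<subseteq> Field \<kappa>}" "\<And>f. range f \<subseteq> Field \<kappa> \<Longrightarrow> \<Theta> f \<in> Field \<kappa>"
    using sequence_coding by blast
  define J where "J a b = \<Theta> (\<lambda>n::nat. if n = 0 then a else b)" for a b
  have JF: "J a b \<in> Field \<kappa>" if "a \<in> Field \<kappa>" "b \<in> Field \<kappa>" for a b
    unfolding J_def using that by (intro \<Theta>(2)) auto
  have J: "a = a' \<and> b = b'"
    if "J a b = J a' b'" "a \<in> Field \<kappa>" "b \<in> Field \<kappa>" "a' \<in> Field \<kappa>" "b' \<in> Field \<kappa>" for a b a' b'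
  proof -
    have "(\<lambda>n::nat. if n = 0 then a else b) = (\<lambda>n. if n = 0 then a' else b')"
      using that by (intro inj_onD[OF \<Theta>(1)]) (auto simp: J_def)
    from fun_cong[OF this, of 0] fun_cong[OF this, of 1] show ?thesis by simp
  qed
  have "\<exists>\<beta>. \<beta> \<in> Field \<kappa> \<and> s f \<subseteq> underS \<kappa> (J (e f) \<beta>)" if f: "f \<in> B" for f
  proof -
    have ef: "e f \<in> Field \<kappa>" using f e(2) by blast
    obtain \<xi> where \<xi>: "\<xi> \<in> Field \<kappa>" "s f \<subseteq> underS \<kappa> \<xi>"
      using countable_strictly_bounded s[OF f] by blast
    have "inj_on (J (e f)) (Field \<kappa>)" 
      by (rule inj_onI) (use J ef in blast)
    then have "\<not> J (e f) ` Field \<kappa> \<subseteq> underS \<kappa> \<xi>"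
      using no_injection_into_initial_segment \<xi>(1) by blast
    then obtain \<beta> where \<beta>: "\<beta> \<in> Field \<kappa>" "J (e f) \<beta> \<notin> underS \<kappa> \<xi>" by blast
    have "(\<xi>, J (e f) \<beta>) \<in> \<kappa>" by (rule underS_total[OF \<xi>(1) JF[OF ef \<beta>(1)] \<beta>(2)])
    then show ?thesis using \<xi>(2) \<beta>(1) underS_mono by blast
  qed
  then obtain \<beta> where \<beta>: "\<And>f. f \<in> B \<Longrightarrow> \<beta> f \<in> Field \<kappa> \<and> s f \<subseteq> underS \<kappa> (J (e f) (\<beta> f))" by metis
  show thesis
  proof (rule that[of "\<lambda>f. J (e f) (\<beta> f)"])
    show "inj_on (\<lambda>f. J (e f) (\<beta> f)) B"
    proof (rule inj_onI)
      fix f g assume fg: "f \<in> B" "g \<in> B" "J (e f) (\<beta> f) = J (e g) (\<beta> g)"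
      have "e f \<in> Field \<kappa>" "e g \<in> Field \<kappa>" using e(2) fg by blast+
      then have "e f = e g" using J[OF fg(3)] \<beta>[OF fg(1)] \<beta>[OF fg(2)] by blast
      then show "f = g" by (rule inj_onD[OF e(1) _ fg(1,2)])
    qed
    show "J (e f) (\<beta> f) \<in> Field \<kappa> \<and> s f \<subseteq> underS \<kappa> (J (e f) (\<beta> f))" if "f \<in> B" for f
    proof -
      have "e f \<in> Field \<kappa>" using e(2) that by blast
      then show ?thesis using JF \<beta>[OF that] by blast
    qed
  qed
qed

text \<open>
  An element of the direct sum is coded by an enumeration of its graph, so a sequence of elements
  becomes a double sequence in \<open>Field \<kappa> \<times> \<rat>\<close>.\<close>
lemma sequences_inject:
  obtains e :: "(nat \<Rightarrow> 'k \<Rightarrow>\<^sub>0 rat) \<Rightarrow> 'k" where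
    "inj_on e {w. \<forall>n. w n \<in> rat_direct_sum \<kappa>}" "e ` {w. \<forall>n. w n \<in> rat_direct_sum \<kappa>} \<subseteq> Field \<kappa>"
proof -
  obtain \<Theta> :: "(nat \<Rightarrow> 'k) \<Rightarrow> 'k" where \<Theta>: "inj_on \<Theta> {f. range f \<subseteq> Field \<kappa>}" "\<And>f. range f \<subseteq> Field \<kappa> \<Longrightarrow> \<Theta> f \<in> Field \<kappa>"
    using sequence_coding by blast
  obtain i :: "nat \<Rightarrow> 'k" where i: "inj i" "range i \<subseteq> Field \<kappa>"
    using infinite_countable_subset[OF inf] by blast
  define \<mu>0 where "\<mu>0 = i 0"
  have \<mu>0: "\<mu>0 \<in> Field \<kappa>" using i(2) by (auto simp: \<mu>0_def)
  define pr :: "'k \<times> rat \<Rightarrow> nat \<Rightarrow> 'k" where "pr x n = (if n = 0 then fst x else i (to_nat (snd x)))" for x n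
  have pr_range: "range (pr x) \<subseteq> Field \<kappa>" if "fst x \<in> Field \<kappa>" for x
    using that i(2) by (auto simp: pr_def)
  have pr_inj: "x = y" if "pr x = pr y" for x y
  proof -
    have "fst x = fst y" using fun_cong[OF that, of 0] by (simp add: pr_def)
    moreover have "i (to_nat (snd x)) = i (to_nat (snd y))" using fun_cong[OF that, of 1] by (simp add: pr_def)
    then have "snd x = snd y" using i(1) by (simp add: inj_eq)
    ultimately show ?thesis by (simp add: prod_eq_iff)
  qed
  \<comment> \<open>one extra point makes the graph non-empty and hence the range of a sequence\<close>
  define gr where "gr a = insert (\<mu>0, 0) (graph a)" for a :: "'k \<Rightarrow>\<^sub>0 rat"
  have fin: "countable (gr a)" "gr a \<noteq> {}" for a
    unfolding gr_def by (simp_all add: countable_finite graph_def)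
  have gr_inj: "a = b" if "gr a = gr b" for a b
  proof -
    have "graph c = gr c - {(\<mu>0, 0)}" for c by (auto simp: gr_def graph_def in_keys_iff)
    with that have "graph a = graph b" by simp
    then show ?thesis by (rule injD[OF inj_graph])
  qed
  have gr_F: "fst x \<in> Field \<kappa>" if "x \<in> gr a" "a \<in> rat_direct_sum \<kappa>" for x a
    using that \<mu>0 by (auto simp: gr_def graph_def rat_direct_sum_def)
  define code where "code a = from_nat_into (gr a)" for a
  have code: "range (code a) = gr a" for a unfolding code_def using fin by (simp add: range_from_nat_into)
  define c where "c w n = \<Theta> (pr (code (w (fst (prod_decode n))) (snd (prod_decode n))))"
    for w :: "nat \<Rightarrow> 'k \<Rightarrow>\<^sub>0 rat" and n
  have prF: "range (pr (code (w m) k)) \<subseteq> Field \<kappa>" if "\<forall>n. w n \<in> rat_direct_sum \<kappa>" for w m k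
    using gr_F[of "code (w m) k" "w m"] code[of "w m"] that by (intro pr_range) blast
  have cF: "range (c w) \<subseteq> Field \<kappa>" if "\<forall>n. w n \<in> rat_direct_sum \<kappa>" for w
    using \<Theta>(2)[OF prF[OF that]] by (auto simp: c_def)
  show thesis
  proof (rule that[of "\<lambda>w. \<Theta> (c w)"])
    show "inj_on (\<lambda>w. \<Theta> (c w)) {w. \<forall>n. w n \<in> rat_direct_sum \<kappa>}"
    proof (rule inj_onI, clarify)
      fix w w' assume w: "\<forall>n. w n \<in> rat_direct_sum \<kappa>" "\<forall>n. w' n \<in> rat_direct_sum \<kappa>" and "\<Theta> (c w) = \<Theta> (c w')"
      then have cc: "c w = c w'" using cF by (intro inj_onD[OF \<Theta>(1)]) auto
      have "code (w m) k = code (w' m) k" for m k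
      proof -
        have "\<Theta> (pr (code (w m) k)) = \<Theta> (pr (code (w' m) k))"
          using fun_cong[OF cc, of "prod_encode (m, k)"] by (simp add: c_def)
        then have "pr (code (w m) k) = pr (code (w' m) k)"
          using prF[OF w(1)] prF[OF w(2)] by (intro inj_onD[OF \<Theta>(1)]) auto
        then show ?thesis by (rule pr_inj)
      qed
      then have "code (w m) = code (w' m)" for m by blast
      then have "gr (w m) = gr (w' m)" for m using code by metis
      then show "w = w'" using gr_inj by blast
    qed
    show "(\<lambda>w. \<Theta> (c w)) ` {w. \<forall>n. w n \<in> rat_direct_sum \<kappa>} \<subseteq> Field \<kappa>"
      using \<Theta>(2) cF by blast
  qed
qed

end

section \<open>Rational vector spaces of finitely supported functions and of sequences\<close>

definition rat_scale :: "rat \<Rightarrow> ('k \<Rightarrow>\<^sub>0 rat) \<Rightarrow> 'k \<Rightarrow>\<^sub>0 rat" where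
  "rat_scale q a = Poly_Mapping.map ((*) q) a"

lemma lookup_scale [simp]: "Poly_Mapping.lookup (rat_scale q a) \<mu> = q * Poly_Mapping.lookup a \<mu>"
  by (simp add: rat_scale_def Poly_Mapping.map.rep_eq when_def)

lemma keys_scale_subset: "Poly_Mapping.keys (rat_scale q a) \<subseteq> Poly_Mapping.keys a"
  by (auto simp: in_keys_iff)

lemma scale_single [simp]: "rat_scale q (Poly_Mapping.single \<mu> r) = Poly_Mapping.single \<mu> (q * r)"
  by (rule poly_mapping_eqI) (simp add: lookup_single when_def)

interpretation vec: vector_space rat_scale
  by unfold_locales (auto intro!: poly_mapping_eqI simp: lookup_add algebra_simps)

definition seq_scale :: "rat \<Rightarrow> (nat \<Rightarrow> 'k \<Rightarrow>\<^sub>0 rat) \<Rightarrow> nat \<Rightarrow> 'k \<Rightarrow>\<^sub>0 rat" where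
  "seq_scale q w = (\<lambda>n. rat_scale q (w n))"

lemma seq_scale_apply [simp]: "seq_scale q w n = rat_scale q (w n)"
  by (simp add: seq_scale_def)

lemma vector_space_seq_scale: "vector_space seq_scale"
  unfolding vector_space_def
  by (simp add: seq_scale_def plus_fun_def vec.scale_right_distrib vec.scale_left_distrib)

interpretation seqs: vector_space seq_scale
  by (rule vector_space_seq_scale)

lemma vector_space_pair_seq_scale: "vector_space_pair seq_scale rat_scale"
  by (intro vector_space_pair.intro vector_space_seq_scale vec.vector_space_axioms)

lemma subspace_rat_direct_sum: "vec.subspace (rat_direct_sum \<kappa>)"
proof (rule vec.subspaceI)
  show "0 \<in> rat_direct_sum \<kappa>" by (simp add: rat_direct_sum_def)
  show "a + b \<in> rat_direct_sum \<kappa>" if "a \<in> rat_direct_sum \<kappa>" "b \<in> rat_direct_sum \<kappa>" for a b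
    using that keys_add[of a b] by (auto simp: rat_direct_sum_def)
  show "rat_scale q a \<in> rat_direct_sum \<kappa>" if "a \<in> rat_direct_sum \<kappa>" for q a
    using that keys_scale_subset[of q a] by (auto simp: rat_direct_sum_def)
qed

section \<open>Characters of the direct sum\<close>

lemma separating_character:
  fixes v :: "'k \<Rightarrow>\<^sub>0 rat"
  assumes "v \<noteq> 0"
  shows "\<exists>\<psi>. character_on UNIV \<psi> \<and> \<psi> v = - 1"
proof -
  obtain \<mu> where \<mu>: "Poly_Mapping.lookup v \<mu> \<noteq> 0"
    using assms by (metis poly_mapping_eqI lookup_zero)
  define \<psi> where "\<psi> a = cis (pi * of_rat (Poly_Mapping.lookup a \<mu> / Poly_Mapping.lookup v \<mu>))" for a
  have "character_on UNIV \<psi>"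
    by (auto simp: character_on_def \<psi>_def lookup_add add_divide_distrib of_rat_add distrib_left cis_mult)
  moreover have "\<psi> v = - 1" using \<mu> by (simp add: \<psi>_def)
  ultimately show ?thesis by blast
qed

lemma ultrafilter_limit_exists:
  fixes x :: "nat \<Rightarrow> complex"
  assumes p: "selective_ultrafilter p" and x: "\<And>n. cmod (x n) = 1"
  shows "\<exists>l. (x \<longlongrightarrow> l) p \<and> cmod l = 1"
proof -
  have "filtermap x p \<noteq> bot"
    using selective_ultrafilterD(1)[OF p] by (simp add: filtermap_bot_iff)
  moreover have "eventually (\<lambda>z. z \<in> sphere 0 1) (filtermap x p)"
    using x by (simp add: eventually_filtermap)
  ultimately obtain l where l: "l \<in> sphere 0 1" "inf (nhds l) (filtermap x p) \<noteq> bot"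
    using compact_sphere[of "0::complex" 1] unfolding compact_filter by blast
  have "(x \<longlongrightarrow> l) p"
  proof (rule topological_tendstoI)
    fix S assume "open S" "l \<in> S"
    then have S: "eventually (\<lambda>z. z \<in> S) (nhds l)" by (rule eventually_nhds_in_open)
    show "eventually (\<lambda>n. x n \<in> S) p"
    proof (rule ccontr)
      assume "\<not> ?thesis"
      then have "eventually (\<lambda>n. x n \<notin> S) p" using selective_ultrafilterD(2)[OF p] by blast
      then have "eventually (\<lambda>z. z \<notin> S) (filtermap x p)" by (simp add: eventually_filtermap)
      with S have "eventually (\<lambda>z. False) (inf (nhds l) (filtermap x p))"
        unfolding eventually_inf by blast
      then show False using l(2) by (simp add: eventually_False)
    qed
  qed
  then show ?thesis using l(1) by auto
qed

text \<open>
  The homomorphism on the direct sum with the homomorphism \<open>h \<mu>\<close> on the summand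
  with index \<open>\<mu>\<close>. Well-founded recursion along \<open>\<kappa>\<close> produces
  such a family \<open>h\<close> of homomorphisms.\<close>
definition assemble :: "('k \<Rightarrow> rat \<Rightarrow> complex) \<Rightarrow> ('k \<Rightarrow>\<^sub>0 rat) \<Rightarrow> complex" where
  "assemble h a = (\<Prod>\<mu>\<in>Poly_Mapping.keys a. h \<mu> (Poly_Mapping.lookup a \<mu>))"

lemma assemble_superset:
  assumes "\<And>\<mu>. \<mu> \<in> K \<Longrightarrow> h \<mu> 0 = 1" "finite K" "Poly_Mapping.keys a \<subseteq> K"
  shows "assemble h a = (\<Prod>\<mu>\<in>K. h \<mu> (Poly_Mapping.lookup a \<mu>))"
  unfolding assemble_def
  using assms by (intro prod.mono_neutral_left) (auto simp: in_keys_iff)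

lemma assemble_add:
  assumes "\<And>\<mu>. \<mu> \<in> Poly_Mapping.keys a \<union> Poly_Mapping.keys b \<Longrightarrow> character_on UNIV (h \<mu>)"
  shows "assemble h (a + b) = assemble h a * assemble h b"
proof -
  let ?K = "Poly_Mapping.keys a \<union> Poly_Mapping.keys b"
  have h0: "h \<mu> 0 = 1" if "\<mu> \<in> ?K" for \<mu> using character_on_zero[OF assms[OF that]] by simp
  have "assemble h (a + b) = (\<Prod>\<mu>\<in>?K. h \<mu> (Poly_Mapping.lookup (a + b) \<mu>))"
    by (intro assemble_superset h0 keys_add) auto
  also have "\<dots> = (\<Prod>\<mu>\<in>?K. h \<mu> (Poly_Mapping.lookup a \<mu>) * h \<mu> (Poly_Mapping.lookup b \<mu>))"
    using character_onD(2)[OF assms] by (intro prod.cong) (auto simp: lookup_add)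
  also have "\<dots> = assemble h a * assemble h b"
    using assemble_superset[of ?K h a, OF h0] assemble_superset[of ?K h b, OF h0] by (simp add: prod.distrib)
  finally show ?thesis .
qed

lemma norm_assemble:
  assumes "\<And>\<mu>. \<mu> \<in> Poly_Mapping.keys a \<Longrightarrow> character_on UNIV (h \<mu>)"
  shows "cmod (assemble h a) = 1"
  unfolding assemble_def prod_norm[symmetric]
  using character_onD(1)[OF assms] by (intro prod.neutral) auto

lemma assemble_single:
  assumes "character_on UNIV (h \<mu>)"
  shows "assemble h (Poly_Mapping.single \<mu> q) = h \<mu> q"
  using character_on_zero[OF assms] by (simp add: assemble_def)

lemma character_on_eq_assemble:
  assumes \<phi>: "character_on {a. Poly_Mapping.keys a \<subseteq> E} \<phi>"
    and h: "\<And>\<mu> q. \<mu> \<in> E \<Longrightarrow> h \<mu> q = \<phi> (Poly_Mapping.single \<mu> q)"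
    and a: "Poly_Mapping.keys a \<subseteq> E"
  shows "\<phi> a = assemble h a"
proof -
  have *: "Poly_Mapping.keys (\<Sum>\<mu>\<in>K. Poly_Mapping.single \<mu> (f \<mu>)) \<subseteq> K" 
    if "finite K" for K and f :: "'a \<Rightarrow> rat"
    by (auto simp: in_keys_iff lookup_sum lookup_single when_def if_distrib sum.delta[OF that] split: if_splits)
  have "\<phi> (\<Sum>\<mu>\<in>K. Poly_Mapping.single \<mu> (f \<mu>)) = (\<Prod>\<mu>\<in>K. h \<mu> (f \<mu>))"
    if "finite K" "K \<subseteq> E" for K f
    using that
  proof (induction K)
    case empty
    then show ?case using character_on_zero[OF \<phi>] by simp
  next
    case (insert \<mu> K)
    then show ?case
      using *[of K f] character_onD(2)[OF \<phi>, of "Poly_Mapping.single \<mu> (f \<mu>)" "\<Sum>\<mu>\<in>K. Poly_Mapping.single \<mu> (f \<mu>)"]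
        h[of \<mu> "f \<mu>"]
      by (auto split: if_splits)
  qed
  from this[OF finite_keys a, of "Poly_Mapping.lookup a"]
  have "\<phi> (\<Sum>\<mu>\<in>Poly_Mapping.keys a. Poly_Mapping.single \<mu> (Poly_Mapping.lookup a \<mu>)) = assemble h a"
    unfolding assemble_def .
  moreover have "(\<Sum>\<mu>\<in>Poly_Mapping.keys a. Poly_Mapping.single \<mu> (Poly_Mapping.lookup a \<mu>)) = a"
    by (rule poly_mapping_eqI) (auto simp: lookup_sum lookup_single when_def in_keys_iff)
  ultimately show ?thesis by simp
qed

section \<open>A linear choice of limits\<close>

definition sequences_in :: "'a set \<Rightarrow> (nat \<Rightarrow> 'a) set" where
  "sequences_in G = {w. \<forall>n. w n \<in> G}"

lemma subspace_sequences_in: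
  assumes "vec.subspace G"
  shows "seqs.subspace (sequences_in G)"
  using assms unfolding seqs.subspace_def vec.subspace_def sequences_in_def by simp

definition essentially_constant :: "nat filter \<Rightarrow> (nat \<Rightarrow> 'a) set" where
  "essentially_constant p = {w. \<exists>a. eventually (\<lambda>n. w n = a) p}"

context countably_closed_cardinal
begin

text \<open>
  The map \<open>L\<close> is to become the limit along \<open>p\<close>. A basis of the space of
  all sequences in the direct sum is chosen that extends a basis of the
  \<open>p\<close>-essentially constant ones. On the latter there is no freedom; the other basis
  elements, collected in \<open>\<B>\<close>, are sent to unit vectors with pairwise different
  indices, and the index of the unit vector is taken above the supports of all terms of the
  sequence.\<close>
lemma limit_functional:
  assumes p: "selective_ultrafilter p"
  obtains L :: "(nat \<Rightarrow> 'k \<Rightarrow>\<^sub>0 rat) \<Rightarrow> 'k \<Rightarrow>\<^sub>0 rat" and \<B> \<iota> where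
    "Vector_Spaces.linear seq_scale rat_scale L"
    "\<And>w. w \<in> sequences_in (rat_direct_sum \<kappa>) \<Longrightarrow> L w \<in> rat_direct_sum \<kappa>"
    "\<And>w a. w \<in> sequences_in (rat_direct_sum \<kappa>) \<Longrightarrow> eventually (\<lambda>n. w n = a) p \<Longrightarrow> L w = a"
    "\<B> \<subseteq> sequences_in (rat_direct_sum \<kappa>)" "inj_on \<iota> \<B>"
    "\<And>f n. f \<in> \<B> \<Longrightarrow> \<iota> f \<in> Field \<kappa> \<and> Poly_Mapping.keys (f n) \<subseteq> underS \<kappa> (\<iota> f)"
    "\<And>f. f \<in> \<B> \<Longrightarrow> L f = Poly_Mapping.single (\<iota> f) 1"
    "sequences_in (rat_direct_sum \<kappa>) \<subseteq>
       seqs.span ((essentially_constant p \<inter> sequences_in (rat_direct_sum \<kappa>)) \<union> \<B>)"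
proof -
  define V where "V = sequences_in (rat_direct_sum \<kappa>)"
  define Z where "Z = essentially_constant p \<inter> V"
  obtain B0 where B0: "B0 \<subseteq> Z" "seqs.independent B0" "Z \<subseteq> seqs.span B0"
    using seqs.maximal_independent_subset by blast
  have "B0 \<subseteq> V" using B0(1) by (auto simp: Z_def)
  then obtain B where B: "B0 \<subseteq> B" "B \<subseteq> V" "seqs.independent B" "V \<subseteq> seqs.span B"
    using seqs.maximal_independent_subset_extend[OF _ B0(2)] by blast
  define \<B> where "\<B> = B - B0"
  have \<B>V: "\<B> \<subseteq> V" using B(2) by (auto simp: \<B>_def)
  have mem: "w n \<in> rat_direct_sum \<kappa>" if "w \<in> V" for w n using that by (simp add: V_def sequences_in_def)
  obtain e :: "(nat \<Rightarrow> 'k \<Rightarrow>\<^sub>0 rat) \<Rightarrow> 'k" where "inj_on e V" "e ` V \<subseteq> Field \<kappa>"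
    using sequences_inject unfolding V_def sequences_in_def by blast
  then have e: "inj_on e \<B>" "e ` \<B> \<subseteq> Field \<kappa>" using \<B>V by (auto intro: inj_on_subset)
  have supp: "countable (\<Union>n. Poly_Mapping.keys (f n)) \<and> (\<Union>n. Poly_Mapping.keys (f n)) \<subseteq> Field \<kappa>"
    if "f \<in> \<B>" for f
  proof
    show "countable (\<Union>n. Poly_Mapping.keys (f n))" by (simp add: countable_finite)
    have "f \<in> V" using that \<B>V by blast
    then show "(\<Union>n. Poly_Mapping.keys (f n)) \<subseteq> Field \<kappa>" using mem by (auto simp: rat_direct_sum_def)
  qed
  obtain \<iota> where \<iota>: "inj_on \<iota> \<B>"
    "\<And>f. f \<in> \<B> \<Longrightarrow> \<iota> f \<in> Field \<kappa> \<and> (\<Union>n. Poly_Mapping.keys (f n)) \<subseteq> underS \<kappa> (\<iota> f)"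
    using index_above[of e \<B> "\<lambda>f. \<Union>n. Poly_Mapping.keys (f n)", OF e supp] by blast
  have "\<exists>a. w \<in> Z \<longrightarrow> eventually (\<lambda>n. w n = a) p" for w
    by (auto simp: Z_def essentially_constant_def)
  then obtain v where v: "\<And>w. w \<in> Z \<Longrightarrow> eventually (\<lambda>n. w n = v w) p" by metis
  obtain L where L: "Vector_Spaces.linear seq_scale rat_scale L"
    and LB: "\<And>w. w \<in> B \<Longrightarrow> L w = (if w \<in> B0 then v w else Poly_Mapping.single (\<iota> w) 1)"
    using vector_space_pair.linear_independent_extend[OF vector_space_pair_seq_scale B(3),
        of "\<lambda>w. if w \<in> B0 then v w else Poly_Mapping.single (\<iota> w) 1"] by blast
  interpret L: Vector_Spaces.linear seq_scale rat_scale L by (rule L)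
  have "seqs.span B0 \<subseteq> {w. eventually (\<lambda>n. w n = L w) p}"
  proof (rule seqs.span_minimal)
    show "B0 \<subseteq> {w. eventually (\<lambda>n. w n = L w) p}"
    proof
      fix w assume w: "w \<in> B0"
      then have "w \<in> B" "w \<in> Z" using B(1) B0(1) by blast+
      then show "w \<in> {w. eventually (\<lambda>n. w n = L w) p}" using v w by (simp add: LB)
    qed
    show "seqs.subspace {w. eventually (\<lambda>n. w n = L w) p}"
    proof (rule seqs.subspaceI)
      show "0 \<in> {w. eventually (\<lambda>n. w n = L w) p}" by (simp add: L.zero)
      fix w w' assume "w \<in> {w. eventually (\<lambda>n. w n = L w) p}" "w' \<in> {w. eventually (\<lambda>n. w n = L w) p}"
      then have "eventually (\<lambda>n. w n = L w) p" "eventually (\<lambda>n. w' n = L w') p" by auto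
      then have "eventually (\<lambda>n. (w + w') n = L (w + w')) p"
        by eventually_elim (simp add: L.add)
      then show "w + w' \<in> {w. eventually (\<lambda>n. w n = L w) p}" by simp
    next
      fix q w assume "w \<in> {w. eventually (\<lambda>n. w n = L w) p}"
      then have "eventually (\<lambda>n. w n = L w) p" by auto
      then have "eventually (\<lambda>n. seq_scale q w n = L (seq_scale q w)) p"
        by eventually_elim (simp add: L.scale)
      then show "seq_scale q w \<in> {w. eventually (\<lambda>n. w n = L w) p}" by simp
    qed
  qed
  then have LZ: "eventually (\<lambda>n. w n = L w) p" if "w \<in> Z" for w using that B0(3) by blast
  have const: "L w = a" if "w \<in> V" "eventually (\<lambda>n. w n = a) p" for w a
  proof -
    have "w \<in> Z" using that by (auto simp: Z_def essentially_constant_def)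
    from eventually_conj[OF LZ[OF this] that(2)] obtain n where "w n = L w \<and> w n = a"
      using eventually_happens'[OF selective_ultrafilterD(1)[OF p]] by blast
    then show ?thesis by metis
  qed
  have "seqs.span B \<subseteq> {w. L w \<in> rat_direct_sum \<kappa>}"
  proof (rule seqs.span_minimal)
    show "B \<subseteq> {w. L w \<in> rat_direct_sum \<kappa>}"
    proof clarify
      fix w assume w: "w \<in> B"
      show "L w \<in> rat_direct_sum \<kappa>"
      proof (cases "w \<in> B0")
        case True
        then have "w \<in> Z" using B0(1) by blast
        from LZ[OF this] obtain n where "w n = L w"
          using eventually_happens'[OF selective_ultrafilterD(1)[OF p]] by blast
        moreover have "w n \<in> rat_direct_sum \<kappa>" using mem w B(2) by blast
        ultimately show ?thesis by simp
      next
        case False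
        then have "\<iota> w \<in> Field \<kappa>" using \<iota>(2)[of w] w by (simp add: \<B>_def)
        then show ?thesis using LB[OF w] False by (simp add: rat_direct_sum_def)
      qed
    qed
    show "seqs.subspace {w. L w \<in> rat_direct_sum \<kappa>}"
    proof (rule seqs.subspaceI)
      show "0 \<in> {w. L w \<in> rat_direct_sum \<kappa>}"
        using vec.subspace_0[OF subspace_rat_direct_sum] by (simp add: L.zero)
      show "w + w' \<in> {w. L w \<in> rat_direct_sum \<kappa>}"
        if "w \<in> {w. L w \<in> rat_direct_sum \<kappa>}" "w' \<in> {w. L w \<in> rat_direct_sum \<kappa>}" for w w'
        using that vec.subspace_add[OF subspace_rat_direct_sum] by (simp add: L.add)
      show "seq_scale q w \<in> {w. L w \<in> rat_direct_sum \<kappa>}"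
        if "w \<in> {w. L w \<in> rat_direct_sum \<kappa>}" for q w
        using that vec.subspace_scale[OF subspace_rat_direct_sum] by (simp add: L.scale)
    qed
  qed
  then have LV: "L w \<in> rat_direct_sum \<kappa>" if "w \<in> V" for w using that B(4) by blast
  have "B \<subseteq> Z \<union> \<B>" using B0(1) by (auto simp: \<B>_def)
  then have span: "V \<subseteq> seqs.span (Z \<union> \<B>)" using B(4) seqs.span_mono by blast
  show thesis
  proof (rule that[of L \<B> \<iota>])
    show "Vector_Spaces.linear seq_scale rat_scale L" by (rule L)
    show "\<iota> f \<in> Field \<kappa> \<and> Poly_Mapping.keys (f n) \<subseteq> underS \<kappa> (\<iota> f)" if "f \<in> \<B>" for f n
      using \<iota>(2)[OF that] by blast
    show "L f = Poly_Mapping.single (\<iota> f) 1" if "f \<in> \<B>" for f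
      using LB[of f] that by (simp add: \<B>_def)
  qed (use LV const \<B>V \<iota>(1) span in \<open>simp_all add: V_def Z_def\<close>)
qed

text \<open>
  Outside \<open>E\<close>, the values of \<open>\<phi>\<close> on a summand
  with index \<open>\<iota> f\<close> have to be limits along \<open>p\<close> of those on
  multiples of \<open>f n\<close>, and these are known already at stage \<open>\<iota> f\<close>
  of a recursion along \<open>\<kappa>\<close> because the supports of the \<open>f n\<close> lie
  below \<open>\<iota> f\<close>; on all other summands \<open>\<phi>\<close> may be trivial.
  Compatibility with \<open>L\<close> is a linear condition, so it
  only has to be checked on \<open>p\<close>-essentially constant sequences and on
  \<open>\<B>\<close>.\<close>
lemma extend_character:
  fixes L :: "(nat \<Rightarrow> 'k \<Rightarrow>\<^sub>0 rat) \<Rightarrow> 'k \<Rightarrow>\<^sub>0 rat" and \<iota> :: "(nat \<Rightarrow> 'k \<Rightarrow>\<^sub>0 rat) \<Rightarrow> 'k"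
  assumes p: "selective_ultrafilter p"
    and L: "Vector_Spaces.linear seq_scale rat_scale L"
    and const: "\<And>w a. w \<in> V \<Longrightarrow> eventually (\<lambda>n. w n = a) p \<Longrightarrow> L w = a"
    and inj: "inj_on \<iota> \<B>"
    and below: "\<And>f n. f \<in> \<B> \<Longrightarrow> Poly_Mapping.keys (f n) \<subseteq> underS \<kappa> (\<iota> f)"
    and L\<B>: "\<And>f. f \<in> \<B> \<Longrightarrow> L f = Poly_Mapping.single (\<iota> f) 1"
    and span: "V \<subseteq> seqs.span ((essentially_constant p \<inter> V) \<union> \<B>)"
    and \<psi>: "character_on {a. Poly_Mapping.keys a \<subseteq> E} \<psi>"
    and closed: "\<And>f n. f \<in> \<B> \<Longrightarrow> \<iota> f \<in> E \<Longrightarrow> Poly_Mapping.keys (f n) \<subseteq> E"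
    and lim0: "\<And>f q. f \<in> \<B> \<Longrightarrow> \<iota> f \<in> E \<Longrightarrow>
      ((\<lambda>n. \<psi> (rat_scale q (f n))) \<longlongrightarrow> \<psi> (rat_scale q (Poly_Mapping.single (\<iota> f) 1))) p"
  shows "\<exists>\<phi>. character_on UNIV \<phi> \<and> (\<forall>a. Poly_Mapping.keys a \<subseteq> E \<longrightarrow> \<phi> a = \<psi> a) \<and>
    (\<forall>w\<in>V. ((\<lambda>n. \<phi> (w n)) \<longlongrightarrow> \<phi> (L w)) p)"
proof -
  interpret L: Vector_Spaces.linear seq_scale rat_scale L by (rule L)
  define R where "R = \<kappa> - Id"
  have R: "wf R" unfolding R_def using Card by (simp add: card_order_on_def well_order_on_def)
  have R_iff: "(\<mu>, \<xi>) \<in> R \<longleftrightarrow> \<mu> \<in> underS \<kappa> \<xi>" for \<mu> \<xi> by (auto simp: R_def underS_def)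
  define F :: "('k \<Rightarrow> rat \<Rightarrow> complex) \<Rightarrow> 'k \<Rightarrow> rat \<Rightarrow> complex" where
    "F h \<xi> q = (if \<xi> \<in> E then \<psi> (Poly_Mapping.single \<xi> q)
       else if \<xi> \<in> \<iota> ` \<B> then Lim p (\<lambda>n. assemble h (rat_scale q (inv_into \<B> \<iota> \<xi> n))) else 1)" for h \<xi> q
  have "adm_wf R F"
    unfolding adm_wf_def
  proof (intro allI impI ext)
    fix h h' :: "'k \<Rightarrow> rat \<Rightarrow> complex" and \<xi> q assume agree: "\<forall>\<mu>. (\<mu>, \<xi>) \<in> R \<longrightarrow> h \<mu> = h' \<mu>"
    have "assemble h (rat_scale q (f n)) = assemble h' (rat_scale q (f n))" if f: "f \<in> \<B>" "\<iota> f = \<xi>" for f n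
      unfolding assemble_def
    proof (rule prod.cong[OF refl])
      fix \<mu> assume "\<mu> \<in> Poly_Mapping.keys (rat_scale q (f n))"
      then have "\<mu> \<in> underS \<kappa> \<xi>" using keys_scale_subset[of q "f n"] below[OF f(1), of n] f(2) by blast
      then show "h \<mu> (Poly_Mapping.lookup (rat_scale q (f n)) \<mu>) = h' \<mu> (Poly_Mapping.lookup (rat_scale q (f n)) \<mu>)"
        using agree by (simp add: R_iff)
    qed
    then have "\<xi> \<in> \<iota> ` \<B> \<Longrightarrow> assemble h (rat_scale q (inv_into \<B> \<iota> \<xi> n)) = assemble h' (rat_scale q (inv_into \<B> \<iota> \<xi> n))" for n
      by (simp add: inv_into_into f_inv_into_f)
    then show "F h \<xi> q = F h' \<xi> q" unfolding F_def by simp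
  qed
  define h where "h = wfrec R F"
  have h: "h = F h" unfolding h_def by (rule wfrec_fixpoint[OF R \<open>adm_wf R F\<close>])
  have hE: "h \<xi> q = \<psi> (Poly_Mapping.single \<xi> q)" if "\<xi> \<in> E" for \<xi> q
    using fun_cong[OF fun_cong[OF h, of \<xi>], of q] that by (simp add: F_def)
  have h\<B>: "h (\<iota> f) q = Lim p (\<lambda>n. assemble h (rat_scale q (f n)))" if "f \<in> \<B>" "\<iota> f \<notin> E" for f q
    using fun_cong[OF fun_cong[OF h, of "\<iota> f"], of q] that inj by (simp add: F_def)
  have h1: "h \<xi> q = 1" if "\<xi> \<notin> E" "\<xi> \<notin> \<iota> ` \<B>" for \<xi> q
    using fun_cong[OF fun_cong[OF h, of \<xi>], of q] that by (simp add: F_def)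
  have lim_h: "character_on UNIV (h (\<iota> f)) \<and> ((\<lambda>n. assemble h (rat_scale q (f n))) \<longlongrightarrow> h (\<iota> f) q) p"
    if f: "f \<in> \<B>" "\<iota> f \<notin> E" and IH: "\<And>\<mu>. \<mu> \<in> underS \<kappa> (\<iota> f) \<Longrightarrow> character_on UNIV (h \<mu>)" for f q
  proof -
    have ch: "character_on UNIV (h \<mu>)" if "\<mu> \<in> Poly_Mapping.keys (rat_scale q (f n))" for \<mu> q n
      using that keys_scale_subset[of q "f n"] below[OF f(1), of n] IH by blast
    have lim: "((\<lambda>n. assemble h (rat_scale q (f n))) \<longlongrightarrow> h (\<iota> f) q) p \<and> cmod (h (\<iota> f) q) = 1" for q
    proof -
      have "cmod (assemble h (rat_scale q (f n))) = 1" for n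
        by (rule norm_assemble) (rule ch)
      from ultrafilter_limit_exists[OF p, of "\<lambda>n. assemble h (rat_scale q (f n))", OF this]
      obtain l where l: "((\<lambda>n. assemble h (rat_scale q (f n))) \<longlongrightarrow> l) p" "cmod l = 1" by blast
      have "h (\<iota> f) q = l" unfolding h\<B>[OF f] using selective_ultrafilterD(1)[OF p] l(1) by (rule tendsto_Lim)
      then show ?thesis using l by simp
    qed
    have "h (\<iota> f) (q + r) = h (\<iota> f) q * h (\<iota> f) r" for q r
    proof (rule tendsto_unique[OF selective_ultrafilterD(1)[OF p]])
      show "((\<lambda>n. assemble h (rat_scale (q + r) (f n))) \<longlongrightarrow> h (\<iota> f) (q + r)) p" using lim by blast
      have "assemble h (rat_scale (q + r) (f n)) = assemble h (rat_scale q (f n)) * assemble h (rat_scale r (f n))" for n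
        unfolding vec.scale_left_distrib by (rule assemble_add) (use ch in blast)
      then show "((\<lambda>n. assemble h (rat_scale (q + r) (f n))) \<longlongrightarrow> h (\<iota> f) q * h (\<iota> f) r) p"
        using lim by (simp add: tendsto_mult)
    qed
    then show ?thesis using lim by (simp add: character_on_def)
  qed
  have ch: "character_on UNIV (h \<xi>)" for \<xi>
    using R
  proof (induction \<xi>)
    case (less \<xi>)
    consider "\<xi> \<in> E" | f where "\<xi> \<notin> E" "f \<in> \<B>" "\<xi> = \<iota> f" | "\<xi> \<notin> E" "\<xi> \<notin> \<iota> ` \<B>" by blast
    then show ?case
    proof cases
      case 1
      have S: "Poly_Mapping.single \<xi> q \<in> {a. Poly_Mapping.keys a \<subseteq> E}" for q :: rat
        using 1 by simp
      show ?thesis unfolding character_on_def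
        using character_onD(1)[OF \<psi> S] character_onD(2)[OF \<psi> S S] hE[OF 1] by (simp add: single_add)
    next
      case 2
      then show ?thesis using lim_h[of f] less by (simp add: R_iff)
    next
      case 3
      then show ?thesis using h1 by (simp add: character_on_def)
    qed
  qed
  define \<phi> where "\<phi> = assemble h"
  have \<phi>: "character_on UNIV \<phi>"
    unfolding character_on_def \<phi>_def using ch by (simp add: norm_assemble assemble_add)
  have \<phi>E: "\<phi> a = \<psi> a" if "Poly_Mapping.keys a \<subseteq> E" for a
    unfolding \<phi>_def using character_on_eq_assemble[OF \<psi>, of h, OF _ that] hE by simp
  \<comment> \<open>the quantifier over \<open>q\<close> makes \<open>W\<close> closed under rational multiples\<close>
  define W where "W = {w. \<forall>q. ((\<lambda>n. \<phi> (rat_scale q (w n))) \<longlongrightarrow> \<phi> (rat_scale q (L w))) p}"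
  have "seqs.span ((essentially_constant p \<inter> V) \<union> \<B>) \<subseteq> W"
  proof (rule seqs.span_minimal)
    show "essentially_constant p \<inter> V \<union> \<B> \<subseteq> W"
    proof
      fix w assume "w \<in> essentially_constant p \<inter> V \<union> \<B>"
      then consider a where "eventually (\<lambda>n. w n = a) p" "w \<in> V" | "w \<in> \<B>"
        by (auto simp: essentially_constant_def)
      then show "w \<in> W"
      proof cases
        case 1
        have "eventually (\<lambda>n. \<phi> (rat_scale q (w n)) = \<phi> (rat_scale q (L w))) p" for q
          using 1(1) by eventually_elim (simp add: const[OF 1(2,1)])
        then show ?thesis by (simp add: W_def tendsto_eventually)
      next
        case 2
        have "((\<lambda>n. \<phi> (rat_scale q (w n))) \<longlongrightarrow> \<phi> (rat_scale q (L w))) p" for q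
        proof (cases "\<iota> w \<in> E")
          case True
          have "\<phi> (rat_scale q (w n)) = \<psi> (rat_scale q (w n))" for n
            using closed[OF 2 True, of n] keys_scale_subset[of q "w n"] by (intro \<phi>E) blast
          moreover have "\<phi> (rat_scale q (L w)) = \<psi> (rat_scale q (Poly_Mapping.single (\<iota> w) 1))"
            unfolding L\<B>[OF 2] using True by (intro \<phi>E) simp
          ultimately show ?thesis using lim0[OF 2 True, of q] by simp
        next
          case False
          have "\<phi> (rat_scale q (L w)) = h (\<iota> w) q"
            unfolding L\<B>[OF 2] \<phi>_def by (simp add: assemble_single[OF ch])
          then show ?thesis using lim_h[OF 2 False ch, of q] by (simp add: \<phi>_def)
        qed
        then show ?thesis by (simp add: W_def)
      qed
    qed
    show "seqs.subspace W"
    proof (rule seqs.subspaceI)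
      show "0 \<in> W" by (simp add: W_def L.zero)
      fix w w' assume "w \<in> W" "w' \<in> W"
      then show "w + w' \<in> W"
        by (simp add: W_def L.add vec.scale_right_distrib character_onD(2)[OF \<phi>] tendsto_mult)
    next
      fix r w assume "w \<in> W"
      then show "seq_scale r w \<in> W" by (simp add: W_def L.scale)
    qed
  qed
  then have "w \<in> W" if "w \<in> V" for w using that span by blast
  then have "((\<lambda>n. \<phi> (rat_scale 1 (w n))) \<longlongrightarrow> \<phi> (rat_scale 1 (L w))) p" if "w \<in> V" for w
    using that unfolding W_def by blast
  then have "((\<lambda>n. \<phi> (w n)) \<longlongrightarrow> \<phi> (L w)) p" if "w \<in> V" for w
    using that by simp
  with \<phi> \<phi>E show ?thesis by blast
qed

end

section \<open>Topologies induced by characters\<close>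

definition character_topology :: "'a set \<Rightarrow> ('a \<Rightarrow> complex) set \<Rightarrow> 'a topology" where
  "character_topology G \<Phi> =
     pullback_topology G (\<lambda>a. restrict (\<lambda>\<phi>. \<phi> a) \<Phi>) (product_topology (\<lambda>_. euclidean) \<Phi>)"

lemma topspace_character_topology [simp]: "topspace (character_topology G \<Phi>) = G"
  by (auto simp: character_topology_def topspace_pullback_topology)

lemma continuous_map_into_character_topology:
  assumes "\<And>\<phi>. \<phi> \<in> \<Phi> \<Longrightarrow> continuous_map X euclidean (\<lambda>x. \<phi> (g x))" "\<And>x. x \<in> topspace X \<Longrightarrow> g x \<in> G"
  shows "continuous_map X (character_topology G \<Phi>) g"
  unfolding character_topology_def
proof (rule continuous_map_pullback')
  show "continuous_map X (product_topology (\<lambda>_. euclidean) \<Phi>) ((\<lambda>a. restrict (\<lambda>\<phi>. \<phi> a) \<Phi>) \<circ> g)"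
    using assms(1) by (auto simp: continuous_map_componentwise o_def)
  show "topspace X \<subseteq> g -` G" using assms(2) by blast
qed

lemma continuous_map_character:
  assumes "\<phi> \<in> \<Phi>"
  shows "continuous_map (character_topology G \<Phi>) euclidean \<phi>"
proof -
  have "continuous_map (character_topology G \<Phi>) euclidean ((\<lambda>h. h \<phi>) \<circ> (\<lambda>a. restrict (\<lambda>\<phi>. \<phi> a) \<Phi>))"
    unfolding character_topology_def
    by (intro continuous_map_pullback continuous_map_product_projection assms)
  then show ?thesis using assms by (simp add: o_def)
qed

lemma limitin_character_topology:
  assumes "\<And>n. x n \<in> G"
  shows "limitin (character_topology G \<Phi>) x l F \<longleftrightarrow> l \<in> G \<and> (\<forall>\<phi>\<in>\<Phi>. ((\<lambda>n. \<phi> (x n)) \<longlongrightarrow> \<phi> l) F)"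
proof
  assume L: "limitin (character_topology G \<Phi>) x l F"
  have "((\<lambda>n. \<phi> (x n)) \<longlongrightarrow> \<phi> l) F" if "\<phi> \<in> \<Phi>" for \<phi>
    using continuous_map_limit[OF continuous_map_character[OF that] L] by (simp add: o_def)
  then show "l \<in> G \<and> (\<forall>\<phi>\<in>\<Phi>. ((\<lambda>n. \<phi> (x n)) \<longlongrightarrow> \<phi> l) F)"
    using limitin_topspace[OF L] by simp
next
  assume R: "l \<in> G \<and> (\<forall>\<phi>\<in>\<Phi>. ((\<lambda>n. \<phi> (x n)) \<longlongrightarrow> \<phi> l) F)"
  let ?e = "\<lambda>a. restrict (\<lambda>\<phi>. \<phi> a) \<Phi>"
  have lim: "limitin (product_topology (\<lambda>_. euclidean) \<Phi>) (\<lambda>n. ?e (x n)) (?e l) F"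
    using R by (simp add: limitin_componentwise)
  show "limitin (character_topology G \<Phi>) x l F"
    unfolding limitin_def
  proof (intro conjI allI impI)
    show "l \<in> topspace (character_topology G \<Phi>)" using R by simp
    fix U assume U: "openin (character_topology G \<Phi>) U \<and> l \<in> U"
    then obtain W where W: "openin (product_topology (\<lambda>_. euclidean) \<Phi>) W" "U = ?e -` W \<inter> G"
      unfolding character_topology_def openin_pullback_topology by blast
    then have "eventually (\<lambda>n. ?e (x n) \<in> W) F" using lim U unfolding limitin_def by blast
    then show "eventually (\<lambda>n. x n \<in> U) F" by eventually_elim (simp add: W(2) assms)
  qed
qed

lemma group_topology_on_character_topology:
  assumes G: "0 \<in> G" "\<And>a b. a \<in> G \<Longrightarrow> b \<in> G \<Longrightarrow> a + b \<in> G" "\<And>a. a \<in> G \<Longrightarrow> - a \<in> G"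
    and \<Phi>: "\<And>\<phi>. \<phi> \<in> \<Phi> \<Longrightarrow> character_on G \<phi>"
  shows "group_topology_on G (character_topology G \<Phi>)"
  unfolding group_topology_on_def
proof (intro conjI)
  let ?X = "character_topology G \<Phi>"
  show "topspace ?X = G" by simp
  show "continuous_map (prod_topology ?X ?X) ?X (\<lambda>(a, b). a + b)"
  proof (rule continuous_map_into_character_topology)
    fix \<phi> assume \<phi>: "\<phi> \<in> \<Phi>"
    have "continuous_map (prod_topology ?X ?X) euclidean (\<lambda>x. (\<phi> (fst x), \<phi> (snd x)))"
      unfolding prod_topology_euclidean[symmetric]
      using continuous_map_compose[OF continuous_map_fst continuous_map_character[OF \<phi>]]
        continuous_map_compose[OF continuous_map_snd continuous_map_character[OF \<phi>]]
      by (intro continuous_map_pairedI) (simp_all add: o_def)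
    moreover have "continuous_map euclidean euclidean (\<lambda>z :: complex \<times> complex. fst z * snd z)"
      by (auto simp: continuous_map_iff_continuous2 intro!: continuous_intros)
    ultimately have "continuous_map (prod_topology ?X ?X) euclidean ((\<lambda>z. fst z * snd z) \<circ> (\<lambda>x. (\<phi> (fst x), \<phi> (snd x))))"
      by (rule continuous_map_compose)
    then show "continuous_map (prod_topology ?X ?X) euclidean (\<lambda>x. \<phi> (case x of (a, b) \<Rightarrow> a + b))"
      by (rule continuous_map_eq) (auto simp: character_onD(2)[OF \<Phi>[OF \<phi>]])
  qed (use G in auto)
  show "continuous_map ?X ?X uminus"
  proof (rule continuous_map_into_character_topology)
    fix \<phi> assume \<phi>: "\<phi> \<in> \<Phi>"
    have "continuous_map euclidean euclidean cnj"
      by (auto simp: continuous_map_iff_continuous2 intro!: continuous_intros)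
    from continuous_map_compose[OF continuous_map_character[OF \<phi>] this]
    show "continuous_map ?X euclidean (\<lambda>a. \<phi> (- a))"
      by (rule continuous_map_eq) (simp add: character_on_minus[OF \<Phi>[OF \<phi>] G(1)] G(3))
  qed (use G in auto)
qed

lemma character_on_scale_nat:
  assumes "character_on UNIV \<phi>"
  shows "\<phi> (rat_scale (of_nat j) v) = \<phi> v ^ j"
proof (induction j)
  case 0
  then show ?case using character_on_zero[OF assms] by simp
next
  case (Suc j)
  have "rat_scale (of_nat (Suc j)) v = v + rat_scale (of_nat j) v"
    by (simp add: vec.scale_left_distrib)
  then show ?case using Suc character_onD(2)[OF assms] by simp
qed

text \<open>
  A non-trivial convergent sequence, shifted to have limit \<open>0\<close>, either has an
  injective subsequence or takes a value \<open>v \<noteq> 0\<close> infinitely often. In the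
  second case all characters in \<open>\<Phi>\<close> are \<open>1\<close> at \<open>v\<close>, so
  that the multiples of \<open>v\<close> form an injective sequence that converges to
  \<open>0\<close>.\<close>
lemma no_nontrivial_convergent_sequences_character_topology:
  fixes G :: "('k \<Rightarrow>\<^sub>0 rat) set"
  assumes G: "vec.subspace G" and \<Phi>: "\<And>\<phi>. \<phi> \<in> \<Phi> \<Longrightarrow> character_on UNIV \<phi>"
    and inj_nonnull: "\<And>z :: nat \<Rightarrow> 'k \<Rightarrow>\<^sub>0 rat. inj z \<Longrightarrow> (\<And>j. z j \<in> G) \<Longrightarrow>
      \<exists>\<phi>\<in>\<Phi>. \<not> (\<lambda>j. \<phi> (z j)) \<longlonglongrightarrow> 1"
  shows "no_nontrivial_convergent_sequences (character_topology G \<Phi>)"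
  unfolding no_nontrivial_convergent_sequences_def
proof (intro allI impI)
  fix x :: "nat \<Rightarrow> 'k \<Rightarrow>\<^sub>0 rat" and l
  assume "(\<forall>n. x n \<in> topspace (character_topology G \<Phi>)) \<and>
    limitin (character_topology G \<Phi>) x l sequentially"
  then have x: "\<And>n. x n \<in> G" and "limitin (character_topology G \<Phi>) x l sequentially" by auto
  then have l: "l \<in> G" and lim: "\<And>\<phi>. \<phi> \<in> \<Phi> \<Longrightarrow> (\<lambda>n. \<phi> (x n)) \<longlonglongrightarrow> \<phi> l"
    by (simp_all add: limitin_character_topology)
  define z where "z n = x n - l" for n
  have zG: "z n \<in> G" for n unfolding z_def using G x l by (rule vec.subspace_diff)
  have null: "(\<lambda>n. \<phi> (z n)) \<longlonglongrightarrow> 1" if "\<phi> \<in> \<Phi>" for \<phi>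
  proof -
    have "(\<lambda>n. \<phi> (x n) * cnj (\<phi> l)) \<longlonglongrightarrow> \<phi> l * cnj (\<phi> l)"
      by (intro tendsto_intros lim that)
    moreover have "\<phi> l * cnj (\<phi> l) = 1"
      using character_on_diff[OF \<Phi>[OF that], of l l] character_on_zero[OF \<Phi>[OF that]] by simp
    ultimately show ?thesis unfolding z_def character_on_diff[OF \<Phi>[OF that]] by simp
  qed
  have "finite (range z)"
  proof (rule ccontr)
    assume inf: "infinite (range z)"
    obtain A where A: "inj_on z A" "range z = z ` A" using subset_image_inj[of "range z" z UNIV] by auto
    have "infinite A" using inf A(2) by auto
    then have s: "strict_mono (enumerate A)" "\<And>j. enumerate A j \<in> A"
      by (auto simp: strict_mono_enumerate enumerate_in_set)
    have "inj (\<lambda>j. z (enumerate A j))"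
    proof (rule injI)
      fix i j assume "z (enumerate A i) = z (enumerate A j)"
      then have "enumerate A i = enumerate A j" using inj_onD[OF A(1)] s(2) by blast
      then show "i = j" using strict_mono_eq[OF s(1)] by simp
    qed
    then obtain \<phi> where \<phi>: "\<phi> \<in> \<Phi>" "\<not> (\<lambda>j. \<phi> (z (enumerate A j))) \<longlonglongrightarrow> 1"
      using inj_nonnull[of "\<lambda>j. z (enumerate A j)"] zG by blast
    show False
      using LIMSEQ_subseq_LIMSEQ[OF null[OF \<phi>(1)] s(1)] \<phi>(2) by (simp add: o_def)
  qed
  moreover have "finite {n. z n = v}" if "v \<noteq> 0" for v
  proof (rule ccontr)
    assume inf: "infinite {n. z n = v}"
    then obtain n where "z n = v" using not_finite_existsD by blast
    then have vG: "v \<in> G" using zG by blast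
    have one: "\<phi> v = 1" if "\<phi> \<in> \<Phi>" for \<phi>
    proof -
      have "(\<lambda>j. \<phi> (z (enumerate {n. z n = v} j))) \<longlonglongrightarrow> 1"
        using LIMSEQ_subseq_LIMSEQ[OF null[OF that] strict_mono_enumerate[OF inf]] by (simp add: o_def)
      moreover have "z (enumerate {n. z n = v} j) = v" for j
        using enumerate_in_set[OF inf, of j] by simp
      ultimately have "(\<lambda>j::nat. \<phi> v) \<longlonglongrightarrow> 1" by simp
      then show ?thesis by (simp add: LIMSEQ_const_iff)
    qed
    have "inj (\<lambda>j::nat. rat_scale (of_nat j) v)"
      using \<open>v \<noteq> 0\<close> by (auto intro!: injI)
    moreover have "rat_scale (of_nat j) v \<in> G" for j :: nat using G vG by (rule vec.subspace_scale)
    ultimately obtain \<phi> where \<phi>: "\<phi> \<in> \<Phi>" "\<not> (\<lambda>j. \<phi> (rat_scale (of_nat j) v)) \<longlonglongrightarrow> 1"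
      using inj_nonnull[of "\<lambda>j. rat_scale (of_nat j) v"] by blast
    have "(\<lambda>j. \<phi> (rat_scale (of_nat j) v)) = (\<lambda>_. 1)"
      by (simp add: character_on_scale_nat[OF \<Phi>[OF \<phi>(1)]] one[OF \<phi>(1)])
    then show False using \<phi>(2) by simp
  qed
  ultimately have "finite (\<Union>v\<in>range z - {0}. {n. z n = v})" by blast
  moreover have "{n. x n \<noteq> l} \<subseteq> (\<Union>v\<in>range z - {0}. {n. z n = v})" by (auto simp: z_def)
  ultimately have "finite {n. x n \<noteq> l}" by (rule rev_finite_subset)
  then have "eventually (\<lambda>n. x n = l) sequentially"
    by (simp add: cofinite_eq_sequentially[symmetric] eventually_cofinite)
  then show "\<exists>c. eventually (\<lambda>n. x n = c) sequentially" by blast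
qed

section \<open>Detecting injective sequences\<close>

lemma diagonal_avoidance:
  fixes bad :: "nat \<Rightarrow> nat \<Rightarrow> nat set"
  assumes "\<And>i n. finite (bad i n)"
  obtains r where "\<And>n. n \<le> r n" "\<And>i n. i \<le> n \<Longrightarrow> r n \<notin> bad i n"
proof -
  have "\<exists>j. n \<le> j \<and> (\<forall>i\<le>n. j \<notin> bad i n)" for n
  proof -
    have "infinite ({n..} - (\<Union>i\<le>n. bad i n))"
      using assms by (intro Diff_infinite_finite) (auto simp: infinite_Ici)
    then have "{n..} - (\<Union>i\<le>n. bad i n) \<noteq> {}" by (rule infinite_imp_nonempty)
    then obtain j where "j \<in> {n..} - (\<Union>i\<le>n. bad i n)" by blast
    then show ?thesis by auto
  qed
  then show thesis using that by metis
qed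

text \<open>
  Term \<open>n\<close> of the family consisting of a subsequence of \<open>z\<close>, put in
  front, and of the sequences \<open>u 0, u 1, \<dots>\<close>, where \<open>j\<close> is the
  index used for \<open>z\<close> at place \<open>n\<close>. Keeping \<open>j\<close> apart from
  \<open>n\<close> allows it to be chosen last.\<close>
definition prepend :: "(nat \<Rightarrow> 'a) \<Rightarrow> (nat \<Rightarrow> nat \<Rightarrow> 'a) \<Rightarrow> nat \<Rightarrow> nat \<Rightarrow> nat \<Rightarrow> 'a" where
  "prepend z u k n j = (case k of 0 \<Rightarrow> z j | Suc k' \<Rightarrow> u k' n)"

lemma sum_prepend:
  fixes z :: "nat \<Rightarrow> 'k \<Rightarrow>\<^sub>0 rat"
  shows "(\<Sum>k\<in>#C. prepend z u k n j)
    = rat_scale (of_nat (count C 0)) (z j) + (\<Sum>k\<in>#C. prepend (\<lambda>_. 0) u k n j)"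
proof (induction C)
  case (add k C)
  show ?case
  proof (cases k)
    case 0
    have "rat_scale (1 + of_nat (count C 0)) (z j) = z j + rat_scale (of_nat (count C 0)) (z j)"
      by (simp add: vec.scale_left_distrib)
    with 0 add show ?thesis by (simp add: prepend_def ac_simps)
  next
    case (Suc k')
    with add show ?thesis by (simp add: prepend_def ac_simps)
  qed
qed simp

text \<open>
  If \<open>z\<close> occurs with total coefficient \<open>q \<noteq> 0\<close>, then the equation
  determines \<open>z j\<close>, hence \<open>j\<close>.\<close>
lemma finite_solutions:
  fixes z :: "nat \<Rightarrow> 'k \<Rightarrow>\<^sub>0 rat"
  assumes z: "inj z" and ne: "count C 0 \<noteq> count D 0"
  shows "finite {j. (\<Sum>k\<in>#C. prepend z u k n j) - (\<Sum>k\<in>#D. prepend z u k n j) = a}" (is "finite ?S")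
proof -
  define b where "b = (\<Sum>k\<in>#C. prepend (\<lambda>_. 0) u k n 0) - (\<Sum>k\<in>#D. prepend (\<lambda>_. 0) u k n 0)"
  define q :: rat where "q = of_nat (count C 0) - of_nat (count D 0)"
  have q: "q \<noteq> 0" using ne by (simp add: q_def)
  have const: "prepend (\<lambda>_. 0) u k n j = prepend (\<lambda>_. 0) u k n 0" for k j
    by (simp add: prepend_def split: nat.split)
  have "(\<Sum>k\<in>#C. prepend z u k n j) - (\<Sum>k\<in>#D. prepend z u k n j) = rat_scale q (z j) + b" for j
    unfolding sum_prepend[of z] const[of _ j] b_def q_def vec.scale_left_diff_distrib by simp
  then have "inj_on z ?S \<and> z ` ?S \<subseteq> {rat_scale (inverse q) (a - b)}"
    using z q by (auto simp: inj_on_def inj_def algebra_simps)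
  then show ?thesis by (meson finite.emptyI finite.insertI finite_imageD finite_subset)
qed

context countably_closed_cardinal
begin

text \<open>
  Let \<open>E\<close> be the countable set of coordinates generated by the supports of the
  \<open>z j\<close> in the sense that with \<open>\<iota> f\<close> it contains the supports of
  all \<open>f n\<close>. The sequences \<open>n \<mapsto> q (f n - e)\<close>, with
  \<open>e\<close> the unit vector at \<open>\<iota> f \<in> E\<close>, lie in the kernel of
  \<open>L\<close>; a combination of them that is \<open>p\<close>-essentially constant is
  therefore \<open>p\<close>-essentially \<open>0\<close>. There are countably many of them, so a
  diagonal choice of \<open>r n \<ge> n\<close> makes \<open>z \<circ> r\<close> independent of
  them and of the constants supported in \<open>E\<close>. Interpolation with limit
  \<open>1\<close> on these sequences and limit \<open>- 1\<close> on \<open>z \<circ> r\<close>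
  yields a character on the coordinates in \<open>E\<close>, and its extension does not tend to
  \<open>1\<close> along \<open>z\<close>.\<close>
lemma character_detecting_sequence:
  fixes L :: "(nat \<Rightarrow> 'k \<Rightarrow>\<^sub>0 rat) \<Rightarrow> 'k \<Rightarrow>\<^sub>0 rat" and \<iota> :: "(nat \<Rightarrow> 'k \<Rightarrow>\<^sub>0 rat) \<Rightarrow> 'k"
  assumes p: "selective_ultrafilter p"
    and V: "V = sequences_in (rat_direct_sum \<kappa>)"
    and L: "Vector_Spaces.linear seq_scale rat_scale L"
    and const: "\<And>w a. w \<in> V \<Longrightarrow> eventually (\<lambda>n. w n = a) p \<Longrightarrow> L w = a"
    and \<B>V: "\<B> \<subseteq> V" and inj: "inj_on \<iota> \<B>"
    and below: "\<And>f n. f \<in> \<B> \<Longrightarrow> \<iota> f \<in> Field \<kappa> \<and> Poly_Mapping.keys (f n) \<subseteq> underS \<kappa> (\<iota> f)"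
    and L\<B>: "\<And>f. f \<in> \<B> \<Longrightarrow> L f = Poly_Mapping.single (\<iota> f) 1"
    and span: "V \<subseteq> seqs.span ((essentially_constant p \<inter> V) \<union> \<B>)"
    and z: "inj z"
  shows "\<exists>\<phi>. character_on UNIV \<phi> \<and> (\<forall>w\<in>V. ((\<lambda>n. \<phi> (w n)) \<longlongrightarrow> \<phi> (L w)) p) \<and>
    \<not> (\<lambda>j. \<phi> (z j)) \<longlonglongrightarrow> 1"
proof -
  interpret L: Vector_Spaces.linear seq_scale rat_scale L by (rule L)
  have subV: "seqs.subspace V" unfolding V by (rule subspace_sequences_in[OF subspace_rat_direct_sum])
  have ne: "p \<noteq> bot" by (rule selective_ultrafilterD(1)[OF p])
  define Rel where "Rel = {(\<xi>, \<mu>). \<exists>f\<in>\<B>. \<iota> f = \<xi> \<and> (\<exists>n. \<mu> \<in> Poly_Mapping.keys (f n))}"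
  define E where "E = Rel\<^sup>* `` (\<Union>n. Poly_Mapping.keys (z n))"
  have cE: "countable E" unfolding E_def
  proof (rule countable_rtrancl)
    show "countable (\<Union>n. Poly_Mapping.keys (z n))" by (simp add: countable_finite)
    fix Y :: "'k set" assume Y: "countable Y"
    have "Rel `` Y \<subseteq> (\<Union>\<xi>\<in>Y. \<Union>n. Poly_Mapping.keys (inv_into \<B> \<iota> \<xi> n))"
    proof
      fix \<mu> assume "\<mu> \<in> Rel `` Y"
      then obtain f n where f: "f \<in> \<B>" "\<iota> f \<in> Y" "\<mu> \<in> Poly_Mapping.keys (f n)"
        unfolding Rel_def by blast
      have "inv_into \<B> \<iota> (\<iota> f) = f" using inj f(1) by (rule inv_into_f_f)
      then show "\<mu> \<in> (\<Union>\<xi>\<in>Y. \<Union>n. Poly_Mapping.keys (inv_into \<B> \<iota> \<xi> n))"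
        using f(2,3) by force
    qed
    moreover have "countable (\<Union>\<xi>\<in>Y. \<Union>n. Poly_Mapping.keys (inv_into \<B> \<iota> \<xi> n))"
      using Y by (simp add: countable_finite)
    ultimately show "countable (Rel `` Y)" by (rule countable_subset)
  qed
  have closed: "Poly_Mapping.keys (f n) \<subseteq> E" if "f \<in> \<B>" "\<iota> f \<in> E" for f n
  proof
    fix \<mu> assume "\<mu> \<in> Poly_Mapping.keys (f n)"
    then have "(\<iota> f, \<mu>) \<in> Rel" using that(1) unfolding Rel_def by blast
    then show "\<mu> \<in> E" using that(2) unfolding E_def by (auto intro: rtrancl_into_rtrancl)
  qed
  have zE: "Poly_Mapping.keys (z j) \<subseteq> E" for j unfolding E_def by blast
  define H where "H = {a :: 'k \<Rightarrow>\<^sub>0 rat. Poly_Mapping.keys a \<subseteq> E}"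
  have cH: "countable H" unfolding H_def by (rule countable_supported_in[OF cE])
  have subH: "vec.subspace H"
    unfolding H_def
  proof (rule vec.subspaceI)
    show "0 \<in> {a. Poly_Mapping.keys a \<subseteq> E}" by simp
    show "a + b \<in> {a. Poly_Mapping.keys a \<subseteq> E}"
      if "a \<in> {a. Poly_Mapping.keys a \<subseteq> E}" "b \<in> {a. Poly_Mapping.keys a \<subseteq> E}" for a b
      using that keys_add[of a b] by blast
    show "rat_scale q a \<in> {a. Poly_Mapping.keys a \<subseteq> E}" if "a \<in> {a. Poly_Mapping.keys a \<subseteq> E}" for q a
      using that keys_scale_subset[of q a] by blast
  qed
  define \<gamma> where "\<gamma> f q = seq_scale q f - (\<lambda>_. rat_scale q (Poly_Mapping.single (\<iota> f) 1))" for f q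
  \<comment> \<open>\<open>0\<close> is added because an enumeration needs a non-empty set\<close>
  define \<Gamma> where "\<Gamma> = insert 0 ((\<lambda>(f, q). \<gamma> f q) ` ({f \<in> \<B>. \<iota> f \<in> E} \<times> UNIV))"
  have \<Gamma>: "w \<in> V \<and> L w = 0 \<and> (\<forall>n. w n \<in> H)" if "w \<in> \<Gamma>" for w
  proof (cases "w = 0")
    case True
    then show ?thesis using seqs.subspace_0[OF subV] vec.subspace_0[OF subH] by (simp add: L.zero)
  next
    case False
    then obtain f q where f: "f \<in> \<B>" "\<iota> f \<in> E" and w: "w = \<gamma> f q"
      using \<open>w \<in> \<Gamma>\<close> by (auto simp: \<Gamma>_def)
    let ?c = "rat_scale q (Poly_Mapping.single (\<iota> f) 1) :: 'k \<Rightarrow>\<^sub>0 rat"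
    have c: "(\<lambda>_::nat. ?c) \<in> V"
      using below[OF f(1)] by (auto simp: V sequences_in_def rat_direct_sum_def)
    have fV: "seq_scale q f \<in> V" using \<B>V f(1) seqs.subspace_scale[OF subV] by blast
    have "w \<in> V" unfolding w \<gamma>_def using subV fV c by (rule seqs.subspace_diff)
    moreover have "L w = 0"
      unfolding w \<gamma>_def using const[OF c, of ?c] by (simp add: L.diff L.scale L\<B>[OF f(1)])
    moreover have "w n \<in> H" for n
    proof -
      have "f n \<in> H" using closed[OF f] by (simp add: H_def)
      moreover have "Poly_Mapping.single (\<iota> f) 1 \<in> H" using f(2) by (simp add: H_def)
      ultimately show ?thesis
        unfolding w \<gamma>_def using subH by (simp add: vec.subspace_diff vec.subspace_scale del: scale_single)
    qed
    ultimately show ?thesis by blast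
  qed
  have "countable {f \<in> \<B>. \<iota> f \<in> E}"
  proof (rule countable_image_inj_on)
    show "countable (\<iota> ` {f \<in> \<B>. \<iota> f \<in> E})" by (rule countable_subset[OF _ cE]) auto
    show "inj_on \<iota> {f \<in> \<B>. \<iota> f \<in> E}" by (rule inj_on_subset[OF inj]) auto
  qed
  then have "countable \<Gamma>" unfolding \<Gamma>_def by simp
  define u where "u = from_nat_into \<Gamma>"
  have "range u = \<Gamma>" unfolding u_def by (rule range_from_nat_into[OF _ \<open>countable \<Gamma>\<close>]) (simp add: \<Gamma>_def)
  have u\<Gamma>: "u k \<in> \<Gamma>" for k using \<open>range u = \<Gamma>\<close> by blast
  have uH: "prepend z u k n j \<in> H" for k n j
    using zE[of j] \<Gamma>[OF u\<Gamma>] by (auto simp: prepend_def H_def split: nat.split)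
  define Q where "Q = (UNIV :: nat multiset set) \<times> (UNIV :: nat multiset set) \<times> H"
  have "countable (UNIV :: nat multiset set)"
    unfolding surj_mset[symmetric] by (rule countable_image) simp
  then have "countable Q" unfolding Q_def using cH by (intro countable_SIGMA)
  define tr where "tr = from_nat_into Q"
  have tr: "range tr = Q"
    unfolding tr_def by (rule range_from_nat_into[OF _ \<open>countable Q\<close>])
      (use vec.subspace_0[OF subH] in \<open>auto simp: Q_def\<close>)
  \<comment> \<open>indices \<open>j\<close> that would create the \<open>i\<close>-th relation involving \<open>z\<close> at place \<open>n\<close>\<close>
  define bad where "bad i n = (case tr i of (C, D, a) \<Rightarrow> {j. count C 0 \<noteq> count D 0 \<and>
      (\<Sum>k\<in>#C. prepend z u k n j) - (\<Sum>k\<in>#D. prepend z u k n j) = a})" for i n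
  have "finite (bad i n)" for i n
  proof (cases "tr i")
    case (fields C D a)
    then show ?thesis using finite_solutions[OF z, of C D u n a]
      by (cases "count C 0 = count D 0") (auto simp: bad_def)
  qed
  then obtain r where r: "\<And>n. n \<le> r n" "\<And>i n. i \<le> n \<Longrightarrow> r n \<notin> bad i n"
    using diagonal_avoidance by blast
  define v where "v k n = prepend z u k n (r n)" for k n
  define t :: "nat \<Rightarrow> complex" where "t k = (case k of 0 \<Rightarrow> - 1 | Suc _ \<Rightarrow> 1)" for k
  have t_prod: "(\<Prod>k\<in>#C. t k) = (- 1) ^ count C 0" for C
    by (induction C) (auto simp: t_def split: nat.split)
  have indep: "a = 0 \<and> (\<Prod>k\<in>#C. t k) = (\<Prod>k\<in>#D. t k)"
    if ev: "eventually (\<lambda>n. (\<Sum>k\<in>#C. v k n) - (\<Sum>k\<in>#D. v k n) = a) p" for C D a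
  proof -
    have sumH: "(\<Sum>k\<in>#C. v k n) \<in> H" for C n
      unfolding v_def by (induction C) (auto simp: vec.subspace_0[OF subH] vec.subspace_add[OF subH] uH)
    obtain n where "(\<Sum>k\<in>#C. v k n) - (\<Sum>k\<in>#D. v k n) = a" using eventually_happens'[OF ne ev] by blast
    then have "a \<in> H" using vec.subspace_diff[OF subH sumH sumH] by blast
    then have "(C, D, a) \<in> range tr" unfolding tr Q_def by simp
    then obtain i where i: "tr i = (C, D, a)" by (metis imageE)
    have eq: "count C 0 = count D 0"
    proof (rule ccontr)
      assume neq: "count C 0 \<noteq> count D 0"
      obtain n where n: "i \<le> n" "(\<Sum>k\<in>#C. v k n) - (\<Sum>k\<in>#D. v k n) = a"
        using eventually_happens'[OF ne eventually_conj[OF eventually_ge_selective[OF p, of i] ev]] by blast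
      then have "r n \<in> bad i n" using i neq by (simp add: bad_def v_def)
      then show False using r(2)[OF n(1)] by blast
    qed
    \<comment> \<open>the part of a combination that does not involve \<open>z\<close>\<close>
    define \<rho> where "\<rho> C n = (\<Sum>k\<in>#C. prepend (\<lambda>_. 0) u k n (r n))" for C n
    have \<rho>: "\<rho> C \<in> V \<and> L (\<rho> C) = 0" for C
    proof (induction C)
      case empty
      have "\<rho> {#} = 0" by (rule ext) (simp add: \<rho>_def)
      then show ?case using seqs.subspace_0[OF subV] L.zero by metis
    next
      case (add k C)
      define w where "w = (case k of 0 \<Rightarrow> 0 | Suc k' \<Rightarrow> u k')"
      have w: "w \<in> V" "L w = 0"
        using \<Gamma>[OF u\<Gamma>] seqs.subspace_0[OF subV] by (auto simp: w_def L.zero split: nat.split)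
      have "\<rho> (add_mset k C) = w + \<rho> C"
        by (rule ext) (simp add: \<rho>_def w_def prepend_def split: nat.split)
      then show ?case using w add seqs.subspace_add[OF subV] L.add add.right_neutral by metis
    qed
    have "eventually (\<lambda>n. (\<rho> C - \<rho> D) n = a) p"
      using ev by eventually_elim (simp add: v_def sum_prepend[of z] \<rho>_def eq)
    from const[OF _ this] have "L (\<rho> C - \<rho> D) = a" using seqs.subspace_diff[OF subV] \<rho> by blast
    then have "a = 0" using \<rho> by (simp add: L.diff)
    then show ?thesis by (simp add: t_prod eq)
  qed
  have "\<exists>\<phi>. character_on H \<phi> \<and> (\<forall>k. ((\<lambda>n. \<phi> (v k n)) \<longlongrightarrow> t k) p)"
  proof (rule character_interpolation[OF separating_character p cH])
    show "a + b \<in> H" if "a \<in> H" "b \<in> H" for a b using vec.subspace_add[OF subH that] .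
    show "v k n \<in> H" for k n unfolding v_def by (rule uH)
    show "cmod (t k) = 1" for k by (simp add: t_def split: nat.split)
  qed (use indep in blast)+
  then obtain \<phi>0 where \<phi>0: "character_on H \<phi>0" and lim0: "\<And>k. ((\<lambda>n. \<phi>0 (v k n)) \<longlongrightarrow> t k) p" by blast
  have lim\<B>: "((\<lambda>n. \<phi>0 (rat_scale q (f n))) \<longlongrightarrow> \<phi>0 (rat_scale q (Poly_Mapping.single (\<iota> f) 1))) p"
    if f: "f \<in> \<B>" "\<iota> f \<in> E" for f q
  proof -
    let ?c = "rat_scale q (Poly_Mapping.single (\<iota> f) 1) :: 'k \<Rightarrow>\<^sub>0 rat"
    have "\<gamma> f q \<in> range u" unfolding \<open>range u = \<Gamma>\<close> \<Gamma>_def using f by auto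
    then obtain k where k: "u k = \<gamma> f q" by (metis imageE)
    have c: "?c \<in> H" using f(2) by (simp add: H_def)
    have "((\<lambda>n. \<phi>0 (u k n)) \<longlongrightarrow> 1) p"
      using lim0[of "Suc k"] by (simp add: v_def prepend_def t_def)
    then have "((\<lambda>n. \<phi>0 (u k n) * \<phi>0 ?c) \<longlongrightarrow> 1 * \<phi>0 ?c) p" by (intro tendsto_intros)
    moreover have "\<phi>0 (u k n) * \<phi>0 ?c = \<phi>0 (rat_scale q (f n))" for n
    proof -
      have "u k n \<in> H" using \<Gamma>[OF u\<Gamma>] by blast
      from character_onD(2)[OF \<phi>0 this c] show ?thesis by (simp add: k \<gamma>_def)
    qed
    ultimately show ?thesis by simp
  qed
  have below': "Poly_Mapping.keys (f n) \<subseteq> underS \<kappa> (\<iota> f)" if "f \<in> \<B>" for f n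
    using below[OF that] by blast
  have "\<exists>\<phi>. character_on UNIV \<phi> \<and> (\<forall>a. Poly_Mapping.keys a \<subseteq> E \<longrightarrow> \<phi> a = \<phi>0 a) \<and>
    (\<forall>w\<in>V. ((\<lambda>n. \<phi> (w n)) \<longlongrightarrow> \<phi> (L w)) p)"
    by (rule extend_character[where \<B> = \<B> and \<iota> = \<iota>])
      (fact p L const inj below' L\<B> span \<phi>0[unfolded H_def] closed lim\<B>)+
  then obtain \<phi> where \<phi>: "character_on UNIV \<phi>" "\<And>a. Poly_Mapping.keys a \<subseteq> E \<Longrightarrow> \<phi> a = \<phi>0 a"
    "\<forall>w\<in>V. ((\<lambda>n. \<phi> (w n)) \<longlongrightarrow> \<phi> (L w)) p" by blast
  have "\<not> (\<lambda>j. \<phi> (z j)) \<longlonglongrightarrow> 1"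
  proof
    assume "(\<lambda>j. \<phi> (z j)) \<longlonglongrightarrow> 1"
    moreover have "filterlim r sequentially p"
      unfolding filterlim_at_top
    proof
      fix N show "eventually (\<lambda>n. N \<le> r n) p"
        using eventually_ge_selective[OF p, of N] by eventually_elim (use r(1) le_trans in blast)
    qed
    ultimately have "((\<lambda>n. \<phi> (z (r n))) \<longlongrightarrow> 1) p" by (rule filterlim_compose)
    moreover have "((\<lambda>n. \<phi> (z (r n))) \<longlongrightarrow> - 1) p"
      using lim0[of 0] by (simp add: v_def prepend_def t_def \<phi>(2)[OF zE])
    ultimately have "(1::complex) = - 1" using ne by (rule tendsto_unique[rotated])
    then show False by simp
  qed
  with \<phi>(1,3) show ?thesis by blast
qed

end

section \<open>Existence of the topology\<close>

theorem theorem2p6: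
  fixes p :: "nat filter" and \<kappa> :: "'k rel"
  assumes "selective_ultrafilter p"
    and "Card_order \<kappa>" and "infinite (Field \<kappa>)"
    and "ordIso2 \<kappa> (BNF_Cardinal_Arithmetic.cexp \<kappa> natLeq)"
  shows "\<exists>X :: ('k \<Rightarrow>\<^sub>0 rat) topology.
           group_topology_on (rat_direct_sum \<kappa>) X \<and>
           p_compact_space p X \<and>
           no_nontrivial_convergent_sequences X"
proof -
  interpret countably_closed_cardinal \<kappa> using assms(2-4) by unfold_locales
  define G where "G = rat_direct_sum \<kappa>"
  have G: "vec.subspace G" unfolding G_def by (rule subspace_rat_direct_sum)
  obtain L :: "(nat \<Rightarrow> 'k \<Rightarrow>\<^sub>0 rat) \<Rightarrow> 'k \<Rightarrow>\<^sub>0 rat" and \<B> \<iota>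
    where L: "Vector_Spaces.linear seq_scale rat_scale L"
      and LG: "\<And>w. w \<in> sequences_in G \<Longrightarrow> L w \<in> G"
      and const: "\<And>w a. w \<in> sequences_in G \<Longrightarrow> eventually (\<lambda>n. w n = a) p \<Longrightarrow> L w = a"
      and \<B>: "\<B> \<subseteq> sequences_in G" "inj_on \<iota> \<B>"
        "\<And>f n. f \<in> \<B> \<Longrightarrow> \<iota> f \<in> Field \<kappa> \<and> Poly_Mapping.keys (f n) \<subseteq> underS \<kappa> (\<iota> f)"
        "\<And>f. f \<in> \<B> \<Longrightarrow> L f = Poly_Mapping.single (\<iota> f) 1"
      and span: "sequences_in G \<subseteq> seqs.span ((essentially_constant p \<inter> sequences_in G) \<union> \<B>)"
    unfolding G_def by (rule limit_functional[OF assms(1)]) blast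
  define \<Phi> where "\<Phi> = {\<phi>. character_on UNIV \<phi> \<and>
    (\<forall>w\<in>sequences_in G. ((\<lambda>n. \<phi> (w n)) \<longlongrightarrow> \<phi> (L w)) p)}"
  have \<Phi>: "character_on UNIV \<phi>" if "\<phi> \<in> \<Phi>" for \<phi> using that by (simp add: \<Phi>_def)
  let ?X = "character_topology G \<Phi>"
  have "group_topology_on G ?X"
  proof (rule group_topology_on_character_topology)
    show "character_on G \<phi>" if "\<phi> \<in> \<Phi>" for \<phi> using \<Phi>[OF that] by (simp add: character_on_def)
  qed (use G in \<open>simp_all add: vec.subspace_0 vec.subspace_add vec.subspace_neg\<close>)
  moreover have "p_compact_space p ?X"
    unfolding p_compact_space_def
  proof (intro allI impI)
    fix x :: "nat \<Rightarrow> 'k \<Rightarrow>\<^sub>0 rat" assume "\<forall>n. x n \<in> topspace ?X"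
    then have x: "\<And>n. x n \<in> G" by simp
    then have xs: "x \<in> sequences_in G" by (simp add: sequences_in_def)
    have "limitin ?X x (L x) p"
      unfolding limitin_character_topology[OF x] using LG[OF xs] xs by (simp add: \<Phi>_def)
    then show "\<exists>l. limitin ?X x l p" ..
  qed
  moreover have "no_nontrivial_convergent_sequences ?X"
  proof (rule no_nontrivial_convergent_sequences_character_topology[OF G \<Phi>])
    fix z :: "nat \<Rightarrow> 'k \<Rightarrow>\<^sub>0 rat" assume z: "inj z"
    have "\<exists>\<phi>. character_on UNIV \<phi> \<and> (\<forall>w\<in>sequences_in G. ((\<lambda>n. \<phi> (w n)) \<longlongrightarrow> \<phi> (L w)) p) \<and>
        \<not> (\<lambda>j. \<phi> (z j)) \<longlonglongrightarrow> 1"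
      by (rule character_detecting_sequence[where \<B> = \<B> and \<iota> = \<iota>])
        (fact assms(1) L const \<B> span z arg_cong[OF G_def, of sequences_in])+
    then show "\<exists>\<phi>\<in>\<Phi>. \<not> (\<lambda>j. \<phi> (z j)) \<longlonglongrightarrow> 1" by (auto simp: \<Phi>_def)
  qed
  ultimately show ?thesis unfolding G_def by blast
qed

end
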